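(* Let $a_0,\dots,a_7$ be real numbers and let $M$ be an $n$-dimensional $\xi$-$\mathcal{T}_a$-flat $(N(k),\xi)$-semi-Riemannian manifold with scalar curvature $r$. 1. If $a_4\neq 0$ and $a_4+(n-1)a_7\neq 0$, then $S=D_2\,g+D_3\,\eta\otimes\eta$, where $$D_2=-\frac{ka_0+k(n-1)a_1+a_7r}{a_4},\qquad D_3=\frac{ka_0-(n-1)k(a_2+a_3+a_5+a_6)+a_7r}{\varepsilon a_4}.$$ Therefore $M$ is an $\eta$-Einstein manifold and $$r=-\frac{k(n-1)(a_0+na_1+a_2+a_3+a_5+a_6)}{a_4+(n-1)a_7}.$$ In particular, $M$ becomes an Einstein manifold provided $ka_0-(n-1)k(a_2+a_3+a_5+a_6)+a_7r=0$. 2. If $a_4=0$ and $a_7\neq 0$, then $$r=-\frac{k(a_0+na_1+a_2+a_3+a_5+a_6)}{a_7}.$$ 3. If $a_4=0$ and $a_7=0$, then either $k=0$ or $a_0+na_1+a_2+a_3+a_5+a_6=0$.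
   Context: Let $(M,g)$ be an $n$-dimensional semi-Riemannian manifold with curvature tensor $R$, Ricci tensor $S$ (with $S(Y,Z)$ the trace of $X\mapsto R(X,Y)Z$), Ricci operator $Q$ ($g(QX,Y)=S(X,Y)$) and scalar curvature $r$. For real numbers $a_0,\dots,a_7$, the $\mathcal{T}_a$-curvature tensor is $$\mathcal{T}_a(X,Y)Z=a_0R(X,Y)Z+a_1S(Y,Z)X+a_2S(X,Z)Y+a_3S(X,Y)Z+a_4g(Y,Z)QX+a_5g(X,Z)QY+a_6g(X,Y)QZ+a_7r\,(g(Y,Z)X-g(X,Z)Y).$$ For a real number $k$, the $k$-nullity distribution is $N(k):p\mapsto\{Z\in T_pM: R(X,Y)Z=k(g(Y,Z)X-g(X,Z)Y)\text{ for all }X,Y\in T_pM\}$. An $(N(k),\xi)$-semi-Riemannian manifold is a semi-Riemannian manifold with a non-null unit vector field $\xi$ belonging to $N(k)$; $g(\xi,\xi)=\varepsilon$ with $\varepsilon=1$ or $-1$ according as $\xi$ is spacelike or timelike, and $\eta$ is the associated $1$-form, $\eta(X)=\varepsilon g(X,\xi)$, so $\eta(\xi)=1$. It is $\xi$-$\mathcal{T}_a$-flat if $\mathcal{T}_a(X,Y)\xi=0$ for all vector fields $X,Y$. It is $\eta$-Einstein if $S=\alpha g+\beta\,\eta\otimes\eta$ for some functions $\alpha,\beta$, and Einstein if $S$ is a multiple of $g$.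
   Formalization: Parts 2 and 3 are stated for n ≥ 2: for n = 1 they fail, e.g. on the real line (R = S = r = 0, every ξ lies in N(k) for every k) with k = 1, a_0 = 1, a_7 = 1 or 0, and all other a_i = 0. *)

theory Defs
  imports "HOL-Analysis.Analysis"
begin

section \<open>Smooth maps between normed spaces\<close>

text \<open>The set \<open>S\<close> is always open below, so that derivatives \<open>at x\<close> and \<open>at x within S\<close> agree.\<close>

primrec Ck_on :: "nat \<Rightarrow> 'a::real_normed_vector set \<Rightarrow> ('a \<Rightarrow> 'b::real_normed_vector) \<Rightarrow> bool" where
  "Ck_on 0 S f \<longleftrightarrow> continuous_on S f"
| "Ck_on (Suc k) S f \<longleftrightarrow>
     f differentiable_on S \<and> (\<forall>v. Ck_on k S (\<lambda>x. frechet_derivative f (at x) v))"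

definition smooth_on :: "'a::real_normed_vector set \<Rightarrow> ('a \<Rightarrow> 'b::real_normed_vector) \<Rightarrow> bool" where
  "smooth_on S f \<longleftrightarrow> (\<forall>k. Ck_on k S f)"


section \<open>Smooth manifolds\<close>

text \<open>A chart is a pair of its domain and a coordinate map; the values of the map outside the
  domain are irrelevant. The dimension of the manifold is \<open>CARD('n)\<close>. The atlas need not be
  maximal.\<close>

type_synonym ('m, 'n) chart = "'m set \<times> ('m \<Rightarrow> real ^ 'n)"

definition chart_inv :: "('m, 'n) chart \<Rightarrow> real ^ 'n \<Rightarrow> 'm" where
  "chart_inv c = inv_into (fst c) (snd c)"

definition transition :: "('m, 'n) chart \<Rightarrow> ('m, 'n) chart \<Rightarrow> real ^ 'n \<Rightarrow> real ^ 'n" where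
  "transition c d = snd d \<circ> chart_inv c"

locale smooth_manifold =
  fixes M :: "'m topology" and A :: "('m, 'n::finite) chart set"
  assumes nonempty: "topspace M \<noteq> {}"
    and hausdorff: "Hausdorff_space M"
    and second_countable: "second_countable M"
    and chart_domain: "c \<in> A \<Longrightarrow> openin M (fst c)"
    and chart_image: "c \<in> A \<Longrightarrow> open (snd c ` fst c)"
    and chart_homeo: "c \<in> A \<Longrightarrow>
      homeomorphic_map (subtopology M (fst c)) (top_of_set (snd c ` fst c)) (snd c)"
    and charts_cover: "(\<Union>c\<in>A. fst c) = topspace M"
    and charts_compatible: "c \<in> A \<Longrightarrow> d \<in> A \<Longrightarrow>
      smooth_on (snd c ` (fst c \<inter> fst d)) (transition c d)"

definition smooth_function :: "('m, 'n::finite) chart set \<Rightarrow> ('m \<Rightarrow> real) \<Rightarrow> bool" where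
  "smooth_function A f \<longleftrightarrow> (\<forall>c\<in>A. smooth_on (snd c ` fst c) (f \<circ> chart_inv c))"


section \<open>Tangent vectors\<close>

text \<open>A tangent vector at \<open>p\<close> assigns to every chart around \<open>p\<close> a coordinate vector, subject to the
  transformation law given by the derivatives of the transition maps. As a normalisation it
  assigns \<open>0\<close> to everything that is not a chart around \<open>p\<close>. The type below is a copy of the function
  type, carrying the pointwise vector space structure; the tangent space at \<open>p\<close> is a subspace.\<close>

typedef ('m, 'n) tangent_vector = "UNIV :: (('m, 'n) chart \<Rightarrow> real ^ 'n) set"
  morphisms coords Tangent_Vector
  by simp

instantiation tangent_vector :: (type, finite) real_vector
begin

definition "0 = Tangent_Vector (\<lambda>c. 0)"
definition "X + Y = Tangent_Vector (\<lambda>c. coords X c + coords Y c)"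
definition "X - Y = Tangent_Vector (\<lambda>c. coords X c - coords Y c)"
definition "- X = Tangent_Vector (\<lambda>c. - coords X c)"
definition "a *\<^sub>R X = Tangent_Vector (\<lambda>c. a *\<^sub>R coords X c)"

instance
  by standard
    (simp_all add: zero_tangent_vector_def plus_tangent_vector_def minus_tangent_vector_def
      uminus_tangent_vector_def scaleR_tangent_vector_def Tangent_Vector_inverse
      algebra_simps coords_inverse)

end

definition tangent_space ::
    "('m, 'n::finite) chart set \<Rightarrow> 'm \<Rightarrow> ('m, 'n) tangent_vector set" where
  "tangent_space A p = {X.
     (\<forall>c\<in>A. \<forall>d\<in>A. p \<in> fst c \<and> p \<in> fst d \<longrightarrow>
        coords X d = frechet_derivative (transition c d) (at (snd c p)) (coords X c)) \<and>
     (\<forall>c. \<not> (c \<in> A \<and> p \<in> fst c) \<longrightarrow> coords X c = 0)}"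

text \<open>The tangent vector at \<open>p\<close> whose coordinates in the chart \<open>c\<close> around \<open>p\<close> are \<open>u\<close>.\<close>

definition from_coords ::
    "('m, 'n::finite) chart set \<Rightarrow> ('m, 'n) chart \<Rightarrow> 'm \<Rightarrow> real ^ 'n \<Rightarrow> ('m, 'n) tangent_vector" where
  "from_coords A c p u = Tangent_Vector (\<lambda>d.
     if d \<in> A \<and> p \<in> fst d then frechet_derivative (transition c d) (at (snd c p)) u else 0)"

definition smooth_vector_field ::
    "'m topology \<Rightarrow> ('m, 'n::finite) chart set \<Rightarrow> ('m \<Rightarrow> ('m, 'n) tangent_vector) \<Rightarrow> bool" where
  "smooth_vector_field M A X \<longleftrightarrow>
     (\<forall>p\<in>topspace M. X p \<in> tangent_space A p) \<and>
     (\<forall>c\<in>A. smooth_on (snd c ` fst c) (\<lambda>x. coords (X (chart_inv c x)) c))"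

text \<open>Curvature and traces are computed in some chart around the given point. As usual, the
  results do not depend on the choice of that chart.\<close>

definition chart_at :: "('m, 'n::finite) chart set \<Rightarrow> 'm \<Rightarrow> ('m, 'n) chart" where
  "chart_at A p = (SOME c. c \<in> A \<and> p \<in> fst c)"

text \<open>Trace of an endomorphism of the tangent space at \<open>p\<close>, via its matrix in the coordinate
  basis of a chart.\<close>

definition tangent_trace ::
    "('m, 'n::finite) chart set \<Rightarrow> 'm \<Rightarrow>
     (('m, 'n) tangent_vector \<Rightarrow> ('m, 'n) tangent_vector) \<Rightarrow> real" where
  "tangent_trace A p F =
     (let c = chart_at A p in trace (matrix (\<lambda>u. coords (F (from_coords A c p u)) c)))"


section \<open>Semi-Riemannian metrics\<close>

type_synonym ('m, 'n) metric_field =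
  "'m \<Rightarrow> ('m, 'n) tangent_vector \<Rightarrow> ('m, 'n) tangent_vector \<Rightarrow> real"

text \<open>The metric in the chart \<open>c\<close>, as a function of the coordinate point \<open>x\<close>.\<close>

definition local_metric ::
    "('m, 'n::finite) chart set \<Rightarrow> ('m, 'n) metric_field \<Rightarrow> ('m, 'n) chart \<Rightarrow>
     real ^ 'n \<Rightarrow> real ^ 'n \<Rightarrow> real ^ 'n \<Rightarrow> real" where
  "local_metric A g c x u v =
     g (chart_inv c x) (from_coords A c (chart_inv c x) u) (from_coords A c (chart_inv c x) v)"

text \<open>The index at \<open>p\<close>: the largest dimension of a subspace on which the metric is negative
  definite.\<close>

definition metric_index ::
    "('m, 'n::finite) chart set \<Rightarrow> ('m, 'n) metric_field \<Rightarrow> 'm \<Rightarrow> nat" where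
  "metric_index A g p = Max {dim V | V.
     subspace V \<and> V \<subseteq> tangent_space A p \<and> (\<forall>X\<in>V. X \<noteq> 0 \<longrightarrow> g p X X < 0)}"

locale semi_riemannian_manifold = smooth_manifold M A
  for M :: "'m topology" and A :: "('m, 'n::finite) chart set" +
  fixes g :: "('m, 'n) metric_field"
  assumes metric_sym: "p \<in> topspace M \<Longrightarrow> X \<in> tangent_space A p \<Longrightarrow> Y \<in> tangent_space A p \<Longrightarrow>
      g p X Y = g p Y X"
    and metric_add: "p \<in> topspace M \<Longrightarrow> X \<in> tangent_space A p \<Longrightarrow> Y \<in> tangent_space A p \<Longrightarrow>
      Z \<in> tangent_space A p \<Longrightarrow> g p (X + Y) Z = g p X Z + g p Y Z"
    and metric_scaleR: "p \<in> topspace M \<Longrightarrow> X \<in> tangent_space A p \<Longrightarrow> Y \<in> tangent_space A p \<Longrightarrow>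
      g p (t *\<^sub>R X) Y = t * g p X Y"
    and metric_nondegenerate: "p \<in> topspace M \<Longrightarrow> X \<in> tangent_space A p \<Longrightarrow>
      (\<And>Y. Y \<in> tangent_space A p \<Longrightarrow> g p X Y = 0) \<Longrightarrow> X = 0"
    and metric_smooth: "c \<in> A \<Longrightarrow> smooth_on (snd c ` fst c) (\<lambda>x. local_metric A g c x u v)"
    and constant_index: "p \<in> topspace M \<Longrightarrow> q \<in> topspace M \<Longrightarrow>
      metric_index A g p = metric_index A g q"


section \<open>Levi-Civita connection and curvature\<close>

text \<open>In the chart \<open>c\<close>, the Christoffel symbols of the Levi-Civita connection form the bilinear map
  \<open>christoffel A g c x\<close>, determined by the Koszul formula for constant coordinate fields.\<close>

definition christoffel ::
    "('m, 'n::finite) chart set \<Rightarrow> ('m, 'n) metric_field \<Rightarrow> ('m, 'n) chart \<Rightarrow>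
     real ^ 'n \<Rightarrow> real ^ 'n \<Rightarrow> real ^ 'n \<Rightarrow> real ^ 'n" where
  "christoffel A g c x u v = (THE w. \<forall>z.
     2 * local_metric A g c x w z =
       frechet_derivative (\<lambda>y. local_metric A g c y v z) (at x) u +
       frechet_derivative (\<lambda>y. local_metric A g c y u z) (at x) v -
       frechet_derivative (\<lambda>y. local_metric A g c y u v) (at x) z)"

text \<open>Covariant derivative, Lie bracket and curvature operator of vector fields on the image of a
  chart.\<close>

definition local_nabla ::
    "('m, 'n::finite) chart set \<Rightarrow> ('m, 'n) metric_field \<Rightarrow> ('m, 'n) chart \<Rightarrow>
     (real ^ 'n \<Rightarrow> real ^ 'n) \<Rightarrow> (real ^ 'n \<Rightarrow> real ^ 'n) \<Rightarrow> real ^ 'n \<Rightarrow> real ^ 'n" where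
  "local_nabla A g c X Y x =
     frechet_derivative Y (at x) (X x) + christoffel A g c x (X x) (Y x)"

definition local_bracket ::
    "(real ^ 'n \<Rightarrow> real ^ 'n) \<Rightarrow> (real ^ 'n \<Rightarrow> real ^ 'n) \<Rightarrow> real ^ 'n \<Rightarrow> real ^ 'n" where
  "local_bracket X Y x = frechet_derivative Y (at x) (X x) - frechet_derivative X (at x) (Y x)"

definition local_curvature ::
    "('m, 'n::finite) chart set \<Rightarrow> ('m, 'n) metric_field \<Rightarrow> ('m, 'n) chart \<Rightarrow>
     (real ^ 'n \<Rightarrow> real ^ 'n) \<Rightarrow> (real ^ 'n \<Rightarrow> real ^ 'n) \<Rightarrow> (real ^ 'n \<Rightarrow> real ^ 'n) \<Rightarrow>
     real ^ 'n \<Rightarrow> real ^ 'n" where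
  "local_curvature A g c X Y Z x =
     local_nabla A g c X (local_nabla A g c Y Z) x -
     local_nabla A g c Y (local_nabla A g c X Z) x -
     local_nabla A g c (local_bracket X Y) Z x"

text \<open>Since curvature is tensorial, its value on tangent vectors at \<open>p\<close> may be computed from any
  local extensions; we take those with constant coordinates.\<close>

definition curvature ::
    "('m, 'n::finite) chart set \<Rightarrow> ('m, 'n) metric_field \<Rightarrow> 'm \<Rightarrow>
     ('m, 'n) tangent_vector \<Rightarrow> ('m, 'n) tangent_vector \<Rightarrow> ('m, 'n) tangent_vector \<Rightarrow>
     ('m, 'n) tangent_vector" where
  "curvature A g p X Y Z = (let c = chart_at A p in
     from_coords A c p
       (local_curvature A g c (\<lambda>_. coords X c) (\<lambda>_. coords Y c) (\<lambda>_. coords Z c) (snd c p)))"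

definition ricci ::
    "('m, 'n::finite) chart set \<Rightarrow> ('m, 'n) metric_field \<Rightarrow> 'm \<Rightarrow>
     ('m, 'n) tangent_vector \<Rightarrow> ('m, 'n) tangent_vector \<Rightarrow> real" where
  "ricci A g p Y Z = tangent_trace A p (\<lambda>X. curvature A g p X Y Z)"

definition ricci_operator ::
    "('m, 'n::finite) chart set \<Rightarrow> ('m, 'n) metric_field \<Rightarrow> 'm \<Rightarrow>
     ('m, 'n) tangent_vector \<Rightarrow> ('m, 'n) tangent_vector" where
  "ricci_operator A g p X =
     (THE W. W \<in> tangent_space A p \<and> (\<forall>Y\<in>tangent_space A p. g p W Y = ricci A g p X Y))"

definition scalar_curvature ::
    "('m, 'n::finite) chart set \<Rightarrow> ('m, 'n) metric_field \<Rightarrow> 'm \<Rightarrow> real" where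
  "scalar_curvature A g p = tangent_trace A p (ricci_operator A g p)"


section \<open>The T-curvature tensor and nullity distributions\<close>

text \<open>Only the coefficients \<open>a 0\<close> to \<open>a 7\<close> are used.\<close>

definition T_curvature ::
    "('m, 'n::finite) chart set \<Rightarrow> ('m, 'n) metric_field \<Rightarrow> (nat \<Rightarrow> real) \<Rightarrow> 'm \<Rightarrow>
     ('m, 'n) tangent_vector \<Rightarrow> ('m, 'n) tangent_vector \<Rightarrow> ('m, 'n) tangent_vector \<Rightarrow>
     ('m, 'n) tangent_vector" where
  "T_curvature A g a p X Y Z =
     a 0 *\<^sub>R curvature A g p X Y Z +
     (a 1 * ricci A g p Y Z) *\<^sub>R X +
     (a 2 * ricci A g p X Z) *\<^sub>R Y +
     (a 3 * ricci A g p X Y) *\<^sub>R Z +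
     (a 4 * g p Y Z) *\<^sub>R ricci_operator A g p X +
     (a 5 * g p X Z) *\<^sub>R ricci_operator A g p Y +
     (a 6 * g p X Y) *\<^sub>R ricci_operator A g p Z +
     (a 7 * scalar_curvature A g p) *\<^sub>R (g p Y Z *\<^sub>R X - g p X Z *\<^sub>R Y)"

definition nullity_distribution ::
    "('m, 'n::finite) chart set \<Rightarrow> ('m, 'n) metric_field \<Rightarrow> real \<Rightarrow> 'm \<Rightarrow>
     ('m, 'n) tangent_vector set" where
  "nullity_distribution A g k p = {Z \<in> tangent_space A p.
     \<forall>X\<in>tangent_space A p. \<forall>Y\<in>tangent_space A p.
       curvature A g p X Y Z = k *\<^sub>R (g p Y Z *\<^sub>R X - g p X Z *\<^sub>R Y)}"

locale N_xi_manifold = semi_riemannian_manifold M A g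
  for M :: "'m topology" and A :: "('m, 'n::finite) chart set" and g :: "('m, 'n) metric_field" +
  fixes k :: real and \<xi> :: "'m \<Rightarrow> ('m, 'n) tangent_vector" and \<epsilon> :: real
  assumes xi_smooth: "smooth_vector_field M A \<xi>"
    and epsilon: "\<epsilon> = 1 \<or> \<epsilon> = -1"
    and xi_unit: "p \<in> topspace M \<Longrightarrow> g p (\<xi> p) (\<xi> p) = \<epsilon>"
    and xi_nullity: "p \<in> topspace M \<Longrightarrow> \<xi> p \<in> nullity_distribution A g k p"

definition eta ::
    "('m, 'n) metric_field \<Rightarrow> ('m \<Rightarrow> ('m, 'n) tangent_vector) \<Rightarrow> real \<Rightarrow> 'm \<Rightarrow>
     ('m, 'n) tangent_vector \<Rightarrow> real" where
  "eta g \<xi> \<epsilon> p X = \<epsilon> * g p X (\<xi> p)"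

definition xi_T_flat ::
    "'m topology \<Rightarrow> ('m, 'n::finite) chart set \<Rightarrow> ('m, 'n) metric_field \<Rightarrow> (nat \<Rightarrow> real) \<Rightarrow>
     ('m \<Rightarrow> ('m, 'n) tangent_vector) \<Rightarrow> bool" where
  "xi_T_flat M A g a \<xi> \<longleftrightarrow>
     (\<forall>X Y. smooth_vector_field M A X \<and> smooth_vector_field M A Y \<longrightarrow>
       (\<forall>p\<in>topspace M. T_curvature A g a p (X p) (Y p) (\<xi> p) = 0))"

definition eta_Einstein ::
    "'m topology \<Rightarrow> ('m, 'n::finite) chart set \<Rightarrow> ('m, 'n) metric_field \<Rightarrow>
     ('m \<Rightarrow> ('m, 'n) tangent_vector) \<Rightarrow> real \<Rightarrow> bool" where
  "eta_Einstein M A g \<xi> \<epsilon> \<longleftrightarrow>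
     (\<exists>\<alpha> \<beta>. smooth_function A \<alpha> \<and> smooth_function A \<beta> \<and>
       (\<forall>p\<in>topspace M. \<forall>X\<in>tangent_space A p. \<forall>Y\<in>tangent_space A p.
         ricci A g p X Y = \<alpha> p * g p X Y + \<beta> p * (eta g \<xi> \<epsilon> p X * eta g \<xi> \<epsilon> p Y)))"

text \<open>The Einstein factor is a constant, as is usual.\<close>

definition Einstein ::
    "'m topology \<Rightarrow> ('m, 'n::finite) chart set \<Rightarrow> ('m, 'n) metric_field \<Rightarrow> bool" where
  "Einstein M A g \<longleftrightarrow>
     (\<exists>\<alpha>::real. \<forall>p\<in>topspace M. \<forall>X\<in>tangent_space A p. \<forall>Y\<in>tangent_space A p.
         ricci A g p X Y = \<alpha> * g p X Y)"

end

theory Submission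
  imports Defs
begin

text \<open>
  Since every tangent vector of \<open>M\<close> extends to a global smooth vector field, flatness is the pointwise
  condition \<open>T(X, Y)\<xi> = 0\<close> for tangent vectors \<open>X\<close> and \<open>Y\<close> (\<open>xi_T_flat_pointwise\<close>). With
  \<open>Y = \<xi>\<close> it is a relation between \<open>X\<close>, \<open>g(X, \<xi>)\<xi>\<close>, the Ricci operator \<open>Q X\<close> and terms involving
  \<open>S(\<cdot>, \<xi>)\<close> and \<open>Q \<xi>\<close>. The latter are known: taking the trace of
  \<open>R(X, Y)\<xi> = k (g(Y, \<xi>)X - g(X, \<xi>)Y)\<close> over \<open>X\<close> gives \<open>S(Y, \<xi>) = k (n - 1) g(Y, \<xi>)\<close>, and hence,
  the Ricci tensor being symmetric, \<open>Q \<xi> = k (n - 1)\<xi>\<close>. What remains is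
  \<open>\<epsilon> C X + g(X, \<xi>) E \<xi> + \<epsilon> a\<^sub>4 Q X = 0\<close> with coefficients \<open>C\<close> and \<open>E\<close> that do not
  depend on \<open>X\<close> (\<open>xi_T_flat_equation\<close>).

  If \<open>a\<^sub>4 \<noteq> 0\<close>, this determines \<open>Q\<close>, hence \<open>S\<close>; the trace of \<open>Q\<close> is a linear equation for the scalar
  curvature \<open>r\<close> whose solution, unique if \<open>a\<^sub>4 + (n - 1) a\<^sub>7 \<noteq> 0\<close>, is constant on \<open>M\<close>.
  If \<open>a\<^sub>4 = 0\<close>, the trace of the relation and its value at \<open>\<xi>\<close> force \<open>C = E = 0\<close> when \<open>n \<ge> 2\<close>, and the last two claims are combinations of these two equations.

  Two ingredients take most of the work. The extension of tangent vectors
  (\<open>extend_tangent_vector\<close>) needs the calculus of smooth maps and bump functions. The symmetry of the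
  Ricci tensor (\<open>ricci_sym\<close>) follows from the first Bianchi identity together with the fact that the
  operators \<open>R(Y, Z)\<close> are skew, hence trace-free; the skew-symmetry rests on the equality of mixed
  second derivatives (\<open>second_derivative_symmetric\<close>).
\<close>

section \<open>Calculus of \<open>C\<^sup>k\<close> maps on open sets\<close>

lemma differentiable_on_open_at:
  "open S \<Longrightarrow> f differentiable_on S \<Longrightarrow> x \<in> S \<Longrightarrow> f differentiable (at x)"
  by (simp add: differentiable_on_eq_differentiable_at)

lemma has_derivative_frechet:
  "open S \<Longrightarrow> f differentiable_on S \<Longrightarrow> x \<in> S \<Longrightarrow> (f has_derivative frechet_derivative f (at x)) (at x)"
  using differentiable_on_open_at frechet_derivative_works by blast

lemma Ck_on_Suc_mono: "Ck_on (Suc k) S f \<Longrightarrow> Ck_on k S f"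
proof (induction k arbitrary: f)
  case 0
  then show ?case by (simp add: differentiable_imp_continuous_on)
next
  case (Suc k)
  have "f differentiable_on S" using Suc.prems by simp
  moreover have "Ck_on k S (\<lambda>x. frechet_derivative f (at x) v)" for v
    using Suc.prems by (intro Suc.IH) simp
  ultimately show ?case by simp
qed

lemma Ck_on_cong:
  "open S \<Longrightarrow> (\<And>x. x \<in> S \<Longrightarrow> f x = g x) \<Longrightarrow> Ck_on k S f \<Longrightarrow> Ck_on k S g"
proof (induction k arbitrary: f g)
  case 0
  then show ?case by (metis Ck_on.simps(1) continuous_on_cong)
next
  case (Suc k)
  have d: "(g has_derivative frechet_derivative f (at x)) (at x)" if "x \<in> S" for x
    using has_derivative_transform_within_open[OF has_derivative_frechet[of S f x]] Suc.prems that by auto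
  then have "frechet_derivative f (at x) v = frechet_derivative g (at x) v" if "x \<in> S" for x v
    using frechet_derivative_at[OF d[OF that]] by simp
  then have "Ck_on k S (\<lambda>x. frechet_derivative g (at x) v)" for v
    using Suc.IH[OF Suc.prems(1), of "\<lambda>x. frechet_derivative f (at x) v"] Suc.prems(3) by simp
  moreover have "g differentiable_on S"
    using d unfolding differentiable_on_def differentiable_def
    by (meson has_derivative_at_withinI)
  ultimately show ?case by simp
qed

lemma Ck_on_local:
  "(\<And>x. x \<in> S \<Longrightarrow> \<exists>T. open T \<and> x \<in> T \<and> Ck_on k T f) \<Longrightarrow> Ck_on k S f"
proof (induction k arbitrary: f)
  case 0
  show ?case
    using 0 by (metis Ck_on.simps(1) continuous_at_imp_continuous_on continuous_on_eq_continuous_at)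
next
  case (Suc k)
  have "f differentiable (at x)" if "x \<in> S" for x
    using Suc.prems[OF that] differentiable_on_open_at by auto
  then have "f differentiable_on S" by (simp add: differentiable_at_imp_differentiable_on)
  moreover have "Ck_on k S (\<lambda>x. frechet_derivative f (at x) v)" for v
    using Suc.prems by (intro Suc.IH) fastforce
  ultimately show ?case by simp
qed

text \<open>The derivative may be given by any expression \<open>f'\<close>; on an open set it agrees with
  \<open>frechet_derivative\<close>.\<close>

lemma Ck_on_SucI:
  assumes "open S" and d: "\<And>x. x \<in> S \<Longrightarrow> (f has_derivative f' x) (at x)"
    and c: "\<And>v. Ck_on k S (\<lambda>x. f' x v)"
  shows "Ck_on (Suc k) S f"
proof -
  have "f' x v = frechet_derivative f (at x) v" if "x \<in> S" for x v
    using frechet_derivative_at[OF d[OF that]] by simp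
  then have "Ck_on k S (\<lambda>x. frechet_derivative f (at x) v)" for v
    by (intro Ck_on_cong[OF \<open>open S\<close> _ c[of v]])
  moreover have "f differentiable_on S"
    using d unfolding differentiable_on_def differentiable_def
    by (meson has_derivative_at_withinI)
  ultimately show ?thesis by simp
qed

lemma Ck_on_const: "Ck_on k S (\<lambda>x. c)"
  by (induction k arbitrary: c) auto

lemma Ck_on_add:
  assumes "open S"
  shows "Ck_on k S f \<Longrightarrow> Ck_on k S g \<Longrightarrow> Ck_on k S (\<lambda>x. f x + g x)"
proof (induction k arbitrary: f g)
  case 0
  then show ?case by (simp add: continuous_on_add)
next
  case (Suc k)
  show ?case
  proof (rule Ck_on_SucI[OF assms])
    show "((\<lambda>x. f x + g x) has_derivative
        (\<lambda>v. frechet_derivative f (at x) v + frechet_derivative g (at x) v)) (at x)" if "x \<in> S" for x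
      using Suc.prems that by (intro has_derivative_add has_derivative_frechet[OF assms]) auto
  qed (use Suc in auto)
qed

lemma Ck_on_bilinear:
  assumes "open S" "bounded_bilinear bop"
  shows "Ck_on k S f \<Longrightarrow> Ck_on k S g \<Longrightarrow> Ck_on k S (\<lambda>x. bop (f x) (g x))"
proof (induction k arbitrary: f g)
  case 0
  then show ?case by (simp add: bounded_bilinear.continuous_on[OF assms(2)])
next
  case (Suc k)
  have fg: "Ck_on k S f" "Ck_on k S g" using Suc.prems Ck_on_Suc_mono by blast+
  show ?case
  proof (rule Ck_on_SucI[OF assms(1)])
    show "((\<lambda>x. bop (f x) (g x)) has_derivative
        (\<lambda>v. bop (f x) (frechet_derivative g (at x) v) + bop (frechet_derivative f (at x) v) (g x)))
        (at x)" if "x \<in> S" for x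
      using Suc.prems that
      by (intro bounded_bilinear.FDERIV[OF assms(2)] has_derivative_frechet[OF assms(1)]) auto
    show "Ck_on k S (\<lambda>x. bop (f x) (frechet_derivative g (at x) v)
        + bop (frechet_derivative f (at x) v) (g x))" for v
      using Suc.prems fg by (intro Ck_on_add[OF assms(1)] Suc.IH) auto
  qed
qed

lemma Ck_on_scaleR:
  "open S \<Longrightarrow> Ck_on k S f \<Longrightarrow> Ck_on k S g \<Longrightarrow> Ck_on k S (\<lambda>x. f x *\<^sub>R g x)"
  by (rule Ck_on_bilinear[OF _ bounded_bilinear_scaleR])

lemma Ck_on_linear:
  assumes "open S" "bounded_linear L"
  shows "Ck_on k S f \<Longrightarrow> Ck_on k S (\<lambda>x. L (f x))"
proof (induction k arbitrary: f)
  case 0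
  then show ?case by (simp add: bounded_linear.continuous_on[OF assms(2)])
next
  case (Suc k)
  show ?case
  proof (rule Ck_on_SucI[OF assms(1)])
    show "((\<lambda>x. L (f x)) has_derivative (\<lambda>v. L (frechet_derivative f (at x) v))) (at x)" if "x \<in> S" for x
      using Suc.prems that
      by (intro bounded_linear.has_derivative[OF assms(2)] has_derivative_frechet[OF assms(1)]) auto
  qed (use Suc in auto)
qed

lemma Ck_on_ident: "open S \<Longrightarrow> Ck_on k S (\<lambda>x. x)"
  by (cases k) (auto intro: Ck_on_SucI[where f' = "\<lambda>_ v. v"] Ck_on_const)

lemma Ck_on_sum:
  assumes "open S" "finite I"
  shows "(\<And>i. i \<in> I \<Longrightarrow> Ck_on k S (f i)) \<Longrightarrow> Ck_on k S (\<lambda>x. \<Sum>i\<in>I. f i x)"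
  using assms(2)
  by (induction I rule: finite_induct) (auto simp: Ck_on_const intro!: Ck_on_add[OF assms(1)])

text \<open>The chain rule is expanded in a basis, so that the derivative of the composition is a sum of products
  of functions to which the induction hypothesis applies.\<close>

lemma Ck_on_compose:
  fixes h :: "'a::real_normed_vector \<Rightarrow> 'b::euclidean_space"
  assumes "open S" "open T" "h ` S \<subseteq> T"
  shows "Ck_on k T f \<Longrightarrow> Ck_on k S h \<Longrightarrow> Ck_on k S (\<lambda>x. f (h x))"
proof (induction k arbitrary: f)
  case 0
  then show ?case using continuous_on_compose2 assms(3) by fastforce
next
  case (Suc k)
  have h: "Ck_on k S h" using Suc.prems Ck_on_Suc_mono by blast
  have d: "(f has_derivative frechet_derivative f (at (h x))) (at (h x))" if "x \<in> S" for x
    using Suc.prems that assms by (intro has_derivative_frechet[of T]) auto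
  show ?case
  proof (rule Ck_on_SucI[OF assms(1)])
    fix x assume x: "x \<in> S"
    have comp: "((\<lambda>x. f (h x)) has_derivative
        (\<lambda>v. frechet_derivative f (at (h x)) (frechet_derivative h (at x) v))) (at x)"
      using Suc.prems x
      by (intro has_derivative_compose[where f = h and g = f] d has_derivative_frechet[OF assms(1)]) auto
    have expand: "frechet_derivative f (at (h x)) w
        = (\<Sum>b\<in>Basis. (w \<bullet> b) *\<^sub>R frechet_derivative f (at (h x)) b)" for w :: 'b
    proof -
      have l: "linear (frechet_derivative f (at (h x)))"
        using d[OF x] has_derivative_linear by blast
      have "frechet_derivative f (at (h x)) w = frechet_derivative f (at (h x)) (\<Sum>b\<in>Basis. (w \<bullet> b) *\<^sub>R b)"
        by (simp add: euclidean_representation)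
      then show ?thesis by (simp add: linear_sum[OF l] linear_scale[OF l])
    qed
    from comp show "((\<lambda>x. f (h x)) has_derivative (\<lambda>v. \<Sum>b\<in>Basis.
        (frechet_derivative h (at x) v \<bullet> b) *\<^sub>R frechet_derivative f (at (h x)) b)) (at x)"
      by (simp only: expand[symmetric])
  next
    fix v
    show "Ck_on k S (\<lambda>x. \<Sum>b\<in>Basis.
        (frechet_derivative h (at x) v \<bullet> b) *\<^sub>R frechet_derivative f (at (h x)) b)"
    proof (intro Ck_on_sum[OF assms(1)] Ck_on_scaleR[OF assms(1)])
      show "Ck_on k S (\<lambda>x. frechet_derivative h (at x) v \<bullet> b)" for b
        using Suc.prems by (intro Ck_on_linear[OF assms(1) bounded_linear_inner_left]) simp
      show "Ck_on k S (\<lambda>x. frechet_derivative f (at (h x)) b)" for b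
        by (rule Suc.IH[OF _ h]) (use Suc.prems in auto)
    qed simp
  qed
qed

lemma smooth_on_differentiable_on: "smooth_on S f \<Longrightarrow> f differentiable_on S"
  unfolding smooth_on_def by (metis Ck_on.simps(2))

lemma smooth_on_frechet_derivative:
  "smooth_on S f \<Longrightarrow> smooth_on S (\<lambda>x. frechet_derivative f (at x) v)"
  unfolding smooth_on_def by (metis Ck_on.simps(2))

lemma smooth_on_imp_continuous_on: "smooth_on S f \<Longrightarrow> continuous_on S f"
  using differentiable_imp_continuous_on smooth_on_differentiable_on by blast

text \<open>Both mixed derivatives are the limit of the same second difference quotient.\<close>

lemma second_difference_limit:
  fixes f :: "'a::real_normed_vector \<Rightarrow> real"
  assumes "open U" "x \<in> U" and f: "smooth_on U f"
  shows "((\<lambda>t. (f (x + t *\<^sub>R u + t *\<^sub>R v) - f (x + t *\<^sub>R u) - f (x + t *\<^sub>R v) + f x) / t\<^sup>2) \<longlongrightarrow>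
     frechet_derivative (\<lambda>y. frechet_derivative f (at y) u) (at x) v) (at_right 0)"
proof -
  let ?q = "\<lambda>t. (f (x + t *\<^sub>R u + t *\<^sub>R v) - f (x + t *\<^sub>R u) - f (x + t *\<^sub>R v) + f x) / t\<^sup>2"
  obtain e where e: "e > 0" "ball x e \<subseteq> U" using assms openE by blast
  define N where "N = norm u + norm v + 1"
  have N: "N > 0" by (simp add: N_def add_nonneg_pos)
  have dist_add: "dist x (x + w) = norm w" for w by (simp add: dist_norm)
  have inU: "x + a *\<^sub>R u + b *\<^sub>R v \<in> U"
    if "0 \<le> a" "a \<le> t" "0 \<le> b" "b \<le> t" "t < e / N" for a b t
  proof -
    have "norm (a *\<^sub>R u + b *\<^sub>R v) \<le> a * norm u + b * norm v"
      using that by (metis abs_of_nonneg norm_scaleR norm_triangle_ineq)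
    also have "\<dots> \<le> t * norm u + t * norm v"
      using that by (intro add_mono mult_right_mono) auto
    also have "\<dots> \<le> t * N" using that by (simp add: N_def algebra_simps)
    also have "\<dots> < e" using that N by (simp add: pos_less_divide_eq)
    finally have "x + (a *\<^sub>R u + b *\<^sub>R v) \<in> ball x e" by (simp add: dist_add)
    then show ?thesis using e by (simp add: add.assoc subset_iff)
  qed
  define Du where "Du = (\<lambda>y. frechet_derivative f (at y) u)"
  have Du: "smooth_on U Du" unfolding Du_def using f by (rule smooth_on_frechet_derivative)
  have cont: "isCont (\<lambda>y. frechet_derivative Du (at y) v) x"
    using smooth_on_imp_continuous_on[OF smooth_on_frechet_derivative[OF Du]] assms
    by (simp add: continuous_on_eq_continuous_at)
  \<comment> \<open>Two applications of the mean value theorem, first along \<open>u\<close>, then along \<open>v\<close>.\<close>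
  have mv: "\<exists>a b. 0 \<le> a \<and> a \<le> t \<and> 0 \<le> b \<and> b \<le> t \<and>
      ?q t = frechet_derivative Du (at (x + a *\<^sub>R u + b *\<^sub>R v)) v" if t: "0 < t" "t < e / N" for t
  proof -
    have 1: "((\<lambda>a. f (x + a *\<^sub>R u + b *\<^sub>R v)) has_real_derivative Du (x + a *\<^sub>R u + b *\<^sub>R v)) (at a)"
      if "0 \<le> a" "a \<le> t" "0 \<le> b" "b \<le> t" for a b
    proof -
      have d: "(f has_derivative frechet_derivative f (at (x + a *\<^sub>R u + b *\<^sub>R v)))
          (at (x + a *\<^sub>R u + b *\<^sub>R v))"
        using inU that t f smooth_on_differentiable_on by (intro has_derivative_frechet[OF assms(1)]) auto
      have "((\<lambda>a. f (x + a *\<^sub>R u + b *\<^sub>R v)) has_derivative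
         (\<lambda>s. frechet_derivative f (at (x + a *\<^sub>R u + b *\<^sub>R v)) (s *\<^sub>R u))) (at a)"
        by (rule has_derivative_compose[where f = "\<lambda>a. x + a *\<^sub>R u + b *\<^sub>R v", OF _ d])
          (auto intro!: derivative_eq_intros)
      then show ?thesis
        by (simp add: has_field_derivative_def Du_def linear_scale[OF has_derivative_linear[OF d]]
            mult.commute[of _ "frechet_derivative f _ u"])
    qed
    have 2: "((\<lambda>b. Du (x + a *\<^sub>R u + b *\<^sub>R v)) has_real_derivative
        frechet_derivative Du (at (x + a *\<^sub>R u + b *\<^sub>R v)) v) (at b)"
      if "0 \<le> a" "a \<le> t" "0 \<le> b" "b \<le> t" for a b
    proof -
      have d: "(Du has_derivative frechet_derivative Du (at (x + a *\<^sub>R u + b *\<^sub>R v)))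
          (at (x + a *\<^sub>R u + b *\<^sub>R v))"
        using inU that t Du smooth_on_differentiable_on by (intro has_derivative_frechet[OF assms(1)]) auto
      have "((\<lambda>b. Du (x + a *\<^sub>R u + b *\<^sub>R v)) has_derivative
         (\<lambda>s. frechet_derivative Du (at (x + a *\<^sub>R u + b *\<^sub>R v)) (s *\<^sub>R v))) (at b)"
        by (rule has_derivative_compose[where f = "\<lambda>b. x + a *\<^sub>R u + b *\<^sub>R v", OF _ d])
          (auto intro!: derivative_eq_intros)
      then show ?thesis
        by (simp add: has_field_derivative_def linear_scale[OF has_derivative_linear[OF d]]
            mult.commute[of _ "frechet_derivative Du _ v"])
    qed
    have "\<exists>a. 0 < a \<and> a < t \<and>
      (f (x + t *\<^sub>R u + t *\<^sub>R v) - f (x + t *\<^sub>R u + 0 *\<^sub>R v))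
        - (f (x + 0 *\<^sub>R u + t *\<^sub>R v) - f (x + 0 *\<^sub>R u + 0 *\<^sub>R v))
      = (t - 0) * (Du (x + a *\<^sub>R u + t *\<^sub>R v) - Du (x + a *\<^sub>R u + 0 *\<^sub>R v))"
      using t by (intro MVT2[where f = "\<lambda>a. f (x + a *\<^sub>R u + t *\<^sub>R v) - f (x + a *\<^sub>R u + 0 *\<^sub>R v)"]
          DERIV_diff 1) auto
    then obtain a where a: "0 < a" "a < t"
      and ea: "f (x + t *\<^sub>R u + t *\<^sub>R v) - f (x + t *\<^sub>R u) - f (x + t *\<^sub>R v) + f x
        = t * (Du (x + a *\<^sub>R u + t *\<^sub>R v) - Du (x + a *\<^sub>R u + 0 *\<^sub>R v))" by auto
    have "\<exists>b. 0 < b \<and> b < t \<and> Du (x + a *\<^sub>R u + t *\<^sub>R v) - Du (x + a *\<^sub>R u + 0 *\<^sub>R v)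
        = (t - 0) * frechet_derivative Du (at (x + a *\<^sub>R u + b *\<^sub>R v)) v"
      using t a by (intro MVT2[where f = "\<lambda>b. Du (x + a *\<^sub>R u + b *\<^sub>R v)"] 2) auto
    then obtain b where b: "0 < b" "b < t" and eb: "Du (x + a *\<^sub>R u + t *\<^sub>R v) - Du (x + a *\<^sub>R u + 0 *\<^sub>R v)
        = t * frechet_derivative Du (at (x + a *\<^sub>R u + b *\<^sub>R v)) v" by auto
    have "?q t = frechet_derivative Du (at (x + a *\<^sub>R u + b *\<^sub>R v)) v"
      unfolding ea eb using t by (simp add: power2_eq_square)
    then show ?thesis using a b by (blast intro: less_imp_le)
  qed
  have "(?q \<longlongrightarrow> frechet_derivative Du (at x) v) (at_right 0)"
  proof (rule tendstoI)
    fix \<delta> :: real assume "\<delta> > 0"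
    then obtain s where s: "s > 0"
      "\<And>y. dist y x < s \<Longrightarrow> dist (frechet_derivative Du (at y) v) (frechet_derivative Du (at x) v) < \<delta>"
      using cont unfolding continuous_at_eps_delta by blast
    have close: "dist (?q t) (frechet_derivative Du (at x) v) < \<delta>" if t: "0 < t" "t < min (e / N) (s / N)" for t
    proof -
      have "t < e / N" using t by simp
      from mv[OF t(1) this] obtain a b where ab: "0 \<le> a" "a \<le> t" "0 \<le> b" "b \<le> t"
        and q: "?q t = frechet_derivative Du (at (x + a *\<^sub>R u + b *\<^sub>R v)) v" by blast
      have "norm (a *\<^sub>R u + b *\<^sub>R v) \<le> a * norm u + b * norm v"
        using ab by (metis abs_of_nonneg norm_scaleR norm_triangle_ineq)
      also have "\<dots> \<le> t * norm u + t * norm v"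
        using ab by (intro add_mono mult_right_mono) auto
      also have "\<dots> \<le> t * N" using t by (simp add: N_def algebra_simps)
      also have "\<dots> < s" using t N by (simp add: pos_less_divide_eq)
      finally have "dist (x + a *\<^sub>R u + b *\<^sub>R v) x < s" by (simp add: dist_norm add.assoc)
      then show ?thesis unfolding q by (rule s(2))
    qed
    have small: "eventually (\<lambda>t. 0 < t \<and> t < min (e / N) (s / N)) (at_right (0::real))"
      using eventually_at_right_real[of 0 "min (e / N) (s / N)"] e s N by simp
    show "eventually (\<lambda>t. dist (?q t) (frechet_derivative Du (at x) v) < \<delta>) (at_right 0)"
      by (rule eventually_mono[OF small]) (use close in blast)
  qed
  then show ?thesis by (simp only: Du_def)
qed

lemma second_derivative_symmetric:
  fixes f :: "'a::real_normed_vector \<Rightarrow> real"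
  assumes "open U" "x \<in> U" "smooth_on U f"
  shows "frechet_derivative (\<lambda>y. frechet_derivative f (at y) u) (at x) v
       = frechet_derivative (\<lambda>y. frechet_derivative f (at y) v) (at x) u"
proof (rule tendsto_unique)
  show "((\<lambda>t. (f (x + t *\<^sub>R u + t *\<^sub>R v) - f (x + t *\<^sub>R u) - f (x + t *\<^sub>R v) + f x) / t\<^sup>2) \<longlongrightarrow>
     frechet_derivative (\<lambda>y. frechet_derivative f (at y) u) (at x) v) (at_right 0)"
    by (rule second_difference_limit[OF assms])
  show "((\<lambda>t. (f (x + t *\<^sub>R u + t *\<^sub>R v) - f (x + t *\<^sub>R u) - f (x + t *\<^sub>R v) + f x) / t\<^sup>2) \<longlongrightarrow>
     frechet_derivative (\<lambda>y. frechet_derivative f (at y) v) (at x) u) (at_right 0)"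
    using second_difference_limit[OF assms, of v u]
    by (simp add: algebra_simps)
qed simp

section \<open>Bump functions\<close>

text \<open>The function \<open>exp (- 1 / t) / t ^ m\<close> on the positive half-line, extended by zero. The factor
  \<open>1 / t ^ m\<close> is included because the derivative of each of these functions is a linear combination of two
  others, so that all of them are smooth by one induction.\<close>

definition flat_exp :: "nat \<Rightarrow> real \<Rightarrow> real" where
  "flat_exp m t = (if t \<le> 0 then 0 else exp (- inverse t) * inverse t ^ m)"

lemma flat_exp_tendsto_0: "(flat_exp m \<longlongrightarrow> 0) (at 0)"
proof -
  have "((\<lambda>t. inverse t ^ m / exp (inverse t)) \<longlongrightarrow> (0::real)) (at_right 0)"
    using filterlim_compose[OF tendsto_power_div_exp_0 filterlim_inverse_at_top_right] .
  then have "(flat_exp m \<longlongrightarrow> 0) (at_right 0)"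
    by (rule Lim_transform_eventually)
      (auto simp: flat_exp_def exp_minus field_simps eventually_at_right_field intro!: exI[of _ 1])
  moreover have "(flat_exp m \<longlongrightarrow> 0) (at_left 0)"
    by (rule tendsto_eventually)
      (auto simp: flat_exp_def eventually_at_left_field intro!: exI[of _ "-1"])
  ultimately show ?thesis by (simp add: filterlim_split_at)
qed

lemma flat_exp_has_real_derivative:
  "(flat_exp m has_real_derivative flat_exp (m + 2) t - m * flat_exp (m + 1) t) (at t)"
proof (cases t "0::real" rule: linorder_cases)
  case less
  have "((\<lambda>_. 0) has_real_derivative 0) (at t)" by simp
  then have "(flat_exp m has_real_derivative 0) (at t)"
    by (rule has_field_derivative_transform_within_open[where S = "{..<0}"])
      (use less in \<open>auto simp: flat_exp_def\<close>)
  then show ?thesis using less by (simp add: flat_exp_def)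
next
  case equal
  have "((\<lambda>h. flat_exp m h / h) \<longlongrightarrow> 0) (at 0)"
    using flat_exp_tendsto_0[of "Suc m"]
    by (rule Lim_transform_eventually) (auto simp: flat_exp_def divide_inverse)
  then show ?thesis using equal by (simp add: has_field_derivative_iff flat_exp_def)
next
  case greater
  have "((\<lambda>t. exp (- inverse t) * inverse t ^ m) has_real_derivative
      flat_exp (m + 2) t - m * flat_exp (m + 1) t) (at t)"
    using greater
    apply (auto intro!: derivative_eq_intros simp: flat_exp_def)
    apply (cases m)
     apply (auto simp: power2_eq_square algebra_simps)
    done
  then show ?thesis
    by (rule has_field_derivative_transform_within_open[where S = "{0<..}"])
      (use greater in \<open>auto simp: flat_exp_def\<close>)
qed

lemma Ck_on_flat_exp: "Ck_on k UNIV (flat_exp m)"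
proof (induction k arbitrary: m)
  case 0
  show ?case
    using DERIV_isCont[OF flat_exp_has_real_derivative]
    by (simp add: continuous_at_imp_continuous_on)
next
  case (Suc k)
  show ?case
  proof (rule Ck_on_SucI)
    show "(flat_exp m has_derivative (\<lambda>h. h *\<^sub>R (flat_exp (m + 2) t + (- real m) *\<^sub>R flat_exp (m + 1) t))) (at t)" for t
      using flat_exp_has_real_derivative[of m t]
      by (simp add: has_field_derivative_def mult.commute[of _ "_ - _"])
    show "Ck_on k UNIV (\<lambda>t. h *\<^sub>R (flat_exp (m + 2) t + (- real m) *\<^sub>R flat_exp (m + 1) t))" for h
      by (intro Ck_on_scaleR Ck_on_add Ck_on_const Suc.IH) auto
  qed simp
qed

lemma smooth_bump_exists:
  fixes x0 :: "'a::euclidean_space"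
  assumes "e > 0"
  shows "\<exists>\<psi>::'a \<Rightarrow> real. smooth_on UNIV \<psi> \<and> \<psi> x0 = 1 \<and> (\<forall>x. x \<notin> cball x0 e \<longrightarrow> \<psi> x = 0)"
proof -
  define q where "q = (\<lambda>x. e\<^sup>2 + (-1) *\<^sub>R ((x - x0) \<bullet> (x - x0)))"
  define \<psi> where "\<psi> = (\<lambda>x. inverse (flat_exp 0 (e\<^sup>2)) *\<^sub>R flat_exp 0 (q x))"
  have x: "Ck_on k UNIV (\<lambda>x. x + (- x0))" for k
    by (intro Ck_on_add Ck_on_ident Ck_on_const) auto
  have q: "Ck_on k UNIV q" for k unfolding q_def
    using x by (intro Ck_on_add Ck_on_scaleR Ck_on_bilinear[OF _ bounded_bilinear_inner] Ck_on_const) auto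
  have "Ck_on k UNIV \<psi>" for k unfolding \<psi>_def
    by (intro Ck_on_scaleR Ck_on_const Ck_on_compose[OF _ _ _ Ck_on_flat_exp q]) auto
  moreover have "\<psi> x0 = 1" using assms by (simp add: \<psi>_def q_def flat_exp_def)
  moreover have "\<psi> x = 0" if "x \<notin> cball x0 e" for x
  proof -
    have "e \<le> norm (x - x0)" using that by (simp add: dist_norm norm_minus_commute)
    then have "e\<^sup>2 \<le> (x - x0) \<bullet> (x - x0)"
      using assms power_mono[of e "norm (x - x0)" 2] by (simp add: power2_norm_eq_inner)
    then show ?thesis by (simp add: \<psi>_def q_def flat_exp_def)
  qed
  ultimately show ?thesis unfolding smooth_on_def by blast
qed

section \<open>Bilinear forms and traces in coordinates\<close>

lemma bilinear_left_linear: "bilinear B \<Longrightarrow> linear (\<lambda>u. B u v)"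
  and bilinear_right_linear: "bilinear B \<Longrightarrow> linear (\<lambda>v. B u v)"
  by (simp_all add: bilinear_def)

lemma linear_axis_expansion:
  fixes f :: "real ^ 'n \<Rightarrow> 'b::real_vector"
  assumes "linear f"
  shows "f u = (\<Sum>k\<in>UNIV. u $ k *\<^sub>R f (axis k 1))"
proof -
  have "f u = f (\<Sum>k\<in>UNIV. u $ k *\<^sub>R axis k 1)"
    using basis_expansion[of u] by (simp add: scalar_mult_eq_scaleR)
  then show ?thesis by (simp add: linear_sum[OF assms] linear_scale[OF assms])
qed

text \<open>The Gram matrix of a bilinear form, arranged so that its product with \<open>u\<close> has the entries
  \<open>B u (axis i 1)\<close>.\<close>

definition gram_matrix :: "(real ^ 'n \<Rightarrow> real ^ 'n \<Rightarrow> real) \<Rightarrow> real ^ 'n ^ 'n" where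
  "gram_matrix B = (\<chi> i j. B (axis j 1) (axis i 1))"

lemma gram_matrix_mult:
  "bilinear B \<Longrightarrow> (gram_matrix B *v u) $ i = B u (axis i 1)"
  using linear_axis_expansion[OF bilinear_left_linear[of B "axis i 1"], of u]
  by (simp add: gram_matrix_def matrix_vector_mult_def mult.commute)

lemma gram_matrix_det_nonzero:
  assumes "bilinear B" "\<And>u. (\<And>v. B u v = 0) \<Longrightarrow> u = 0"
  shows "det (gram_matrix B) \<noteq> 0"
proof -
  have "u = 0" if "gram_matrix B *v u = 0" for u
  proof (rule assms(2))
    fix v
    show "B u v = 0"
      using linear_axis_expansion[OF bilinear_right_linear[OF assms(1), of u], of v]
        gram_matrix_mult[OF assms(1), of u] that by simp
  qed
  then have "invertible (gram_matrix B)"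
    using matrix_left_invertible_ker[of "gram_matrix B"] invertible_left_inverse by blast
  then show ?thesis by (simp add: invertible_det_nz)
qed

lemma linear_eq_on_axes:
  fixes L :: "real ^ 'n \<Rightarrow> real"
  assumes "linear L" "linear L'" "\<And>i. L (axis i 1) = L' (axis i 1)"
  shows "L v = L' v"
  using linear_axis_expansion[OF assms(1), of v] linear_axis_expansion[OF assms(2), of v] assms(3)
  by simp

lemma riesz_nondegenerate:
  fixes B :: "real ^ 'n \<Rightarrow> real ^ 'n \<Rightarrow> real"
  assumes "bilinear B" "\<And>u. (\<And>v. B u v = 0) \<Longrightarrow> u = 0" "linear \<omega>"
  shows "\<exists>!w. \<forall>z. B w z = \<omega> z"
proof -
  let ?b = "\<chi> i. \<omega> (axis i 1)"
  have inv: "invertible (gram_matrix B)"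
    using gram_matrix_det_nonzero[OF assms(1,2)] by (simp add: invertible_det_nz)
  then obtain w where w: "gram_matrix B *v w = ?b"
    by (metis invertible_def matrix_vector_mul_assoc matrix_vector_mul_lid)
  have "B w z = \<omega> z" for z
    by (rule linear_eq_on_axes[OF bilinear_right_linear[OF assms(1)] assms(3)])
      (metis gram_matrix_mult[OF assms(1)] w vec_lambda_beta)
  moreover have "w' = w" if "\<forall>z. B w' z = \<omega> z" for w'
  proof -
    have "B (w' - w) z = 0" for z
      using that calculation[of z] by (simp add: bilinear_lsub[OF assms(1)])
    then have "w' - w = 0" by (rule assms(2))
    then show ?thesis by simp
  qed
  ultimately show ?thesis by blast
qed

lemma trace_matrix: "trace (matrix L) = (\<Sum>i\<in>UNIV. L (axis i 1) $ i)"
  by (simp add: trace_def matrix_def)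

text \<open>With \<open>P\<close> the Gram matrix, \<open>Q\<close> its inverse and \<open>L\<close> the matrix of the operator, skewness says
  that \<open>P L Q\<close> is minus the transpose of \<open>L\<close>, while its trace is that of \<open>L\<close>.\<close>

lemma trace_skew_eq_0:
  fixes B :: "real ^ 'n \<Rightarrow> real ^ 'n \<Rightarrow> real" and L :: "real ^ 'n \<Rightarrow> real ^ 'n"
  assumes B: "bilinear B" "\<And>u v. B u v = B v u" "\<And>u. (\<And>v. B u v = 0) \<Longrightarrow> u = 0"
    and L: "linear L" "\<And>u v. B (L u) v + B u (L v) = 0"
  shows "trace (matrix L) = 0"
proof -
  let ?P = "gram_matrix B" and ?L = "matrix L"
  obtain Q where Q: "?P ** Q = mat 1" "Q ** ?P = mat 1"
    using gram_matrix_det_nonzero[OF B(1,3)] invertible_def by (auto simp: invertible_det_nz[symmetric])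
  have col: "(?P ** ?L) $ i $ j = B (L (axis j 1)) (axis i 1)" for i j
  proof -
    have "(?P ** ?L) $ i $ j = (?P *v L (axis j 1)) $ i"
      by (simp add: matrix_matrix_mult_def matrix_vector_mult_def matrix_def)
    then show ?thesis by (simp add: gram_matrix_mult[OF B(1)])
  qed
  have P: "transpose ?P = ?P" using B(2) by (simp add: transpose_def gram_matrix_def vec_eq_iff)
  have "transpose (?P ** ?L) = - (?P ** ?L)"
    unfolding vec_eq_iff
  proof (intro allI)
    fix i j
    show "transpose (?P ** ?L) $ i $ j = (- (?P ** ?L)) $ i $ j"
      using L(2)[of "axis i 1" "axis j 1"] B(2)[of "axis i 1"] by (simp add: transpose_def col)
  qed
  then have "?P ** ?L = - (transpose ?L ** ?P)"
    by (simp add: matrix_transpose_mul P equation_minus_iff)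
  then have "?P ** ?L ** Q = - (transpose ?L ** ?P) ** Q" by simp
  also have "\<dots> = - (transpose ?L ** ?P ** Q)"
    by (simp add: vec_eq_iff matrix_matrix_mult_def sum_negf)
  also have "\<dots> = - transpose ?L" by (simp add: matrix_mul_assoc[symmetric] Q)
  finally have "trace (?P ** ?L ** Q) = trace (- transpose ?L)" by simp
  moreover have "trace (?P ** ?L ** Q) = trace ?L"
    by (subst trace_mul_sym) (simp add: matrix_mul_assoc Q)
  moreover have "trace (- transpose ?L) = - trace ?L"
    by (simp add: trace_def transpose_def sum_negf)
  ultimately show ?thesis by simp
qed

lemma differentiable_det:
  fixes C :: "'a::real_normed_vector \<Rightarrow> real ^ 'n ^ 'n"
  assumes "\<And>i j. (\<lambda>x. C x $ i $ j) differentiable (at x)"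
  shows "(\<lambda>x. det (C x)) differentiable (at x)"
proof -
  have "(\<lambda>x. \<Prod>i\<in>UNIV. C x $ i $ p i) differentiable (at x)" for p
  proof -
    have "\<forall>i. \<exists>D. ((\<lambda>x. C x $ i $ p i) has_derivative D) (at x)"
      using assms by (simp add: differentiable_def)
    then obtain D where D: "\<And>i. ((\<lambda>x. C x $ i $ p i) has_derivative D i) (at x)" by metis
    have "((\<lambda>x. \<Prod>i\<in>UNIV. C x $ i $ p i) has_derivative
        (\<lambda>y. \<Sum>i\<in>UNIV. D i y * (\<Prod>j\<in>UNIV - {i}. C x $ j $ p j))) (at x)"
      by (rule has_derivative_prod) (rule D)
    then show ?thesis unfolding differentiable_def by blast
  qed
  then show ?thesis unfolding det_def
    by (intro differentiable_sum differentiable_mult) auto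
qed

section \<open>Christoffel symbols and curvature of a metric on an open set\<close>

text \<open>A smooth family of nondegenerate symmetric bilinear forms on an open set of \<open>\<real>\<^sup>n\<close>, that is, the
  expression of a semi-Riemannian metric in a chart.\<close>

locale coordinate_metric =
  fixes U :: "(real ^ 'n::finite) set" and G :: "real ^ 'n \<Rightarrow> real ^ 'n \<Rightarrow> real ^ 'n \<Rightarrow> real"
  assumes open_U: "open U"
    and bil: "x \<in> U \<Longrightarrow> bilinear (G x)"
    and sym: "x \<in> U \<Longrightarrow> G x u v = G x v u"
    and nondeg: "x \<in> U \<Longrightarrow> (\<And>v. G x u v = 0) \<Longrightarrow> u = 0"
    and smooth: "smooth_on U (\<lambda>x. G x u v)"
begin

text \<open>The derivative of the coefficient \<open>G(u, v)\<close> at \<open>x\<close> in the direction \<open>z\<close>.\<close>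

definition dG :: "real ^ 'n \<Rightarrow> real ^ 'n \<Rightarrow> real ^ 'n \<Rightarrow> real ^ 'n \<Rightarrow> real" where
  "dG x u v z = frechet_derivative (\<lambda>y. G y u v) (at x) z"

text \<open>The Christoffel symbols of the Levi-Civita connection, characterised by the Koszul formula.\<close>

definition gamma :: "real ^ 'n \<Rightarrow> real ^ 'n \<Rightarrow> real ^ 'n \<Rightarrow> real ^ 'n" where
  "gamma x u v = (THE w. \<forall>z. 2 * G x w z = dG x v z u + dG x u z v - dG x u v z)"

text \<open>The derivative of the Christoffel symbol \<open>\<Gamma>(u, v)\<close> at \<open>x\<close> in the direction \<open>z\<close>.\<close>

definition dgamma :: "real ^ 'n \<Rightarrow> real ^ 'n \<Rightarrow> real ^ 'n \<Rightarrow> real ^ 'n \<Rightarrow> real ^ 'n" where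
  "dgamma x u v z = frechet_derivative (\<lambda>y. gamma y u v) (at x) z"

text \<open>The curvature \<open>R(u, v) w\<close> of constant coordinate fields; as \<open>u\<close> and \<open>v\<close> commute, the
  bracket term is absent.\<close>

definition Rm :: "real ^ 'n \<Rightarrow> real ^ 'n \<Rightarrow> real ^ 'n \<Rightarrow> real ^ 'n \<Rightarrow> real ^ 'n" where
  "Rm x u v w = dgamma x v w u + gamma x u (gamma x v w) - (dgamma x u w v + gamma x v (gamma x u w))"

lemma G_has_derivative:
  "x \<in> U \<Longrightarrow> ((\<lambda>y. G y u v) has_derivative dG x u v) (at x)"
  using has_derivative_frechet[OF open_U smooth_on_differentiable_on[OF smooth], of x u v]
  by (simp add: dG_def[abs_def])

lemma dG_unique:
  assumes "x \<in> U" "(f has_derivative f') (at x)" "\<And>y. y \<in> U \<Longrightarrow> f y = G y u v"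
  shows "dG x u v z = f' z"
proof -
  have "((\<lambda>y. G y u v) has_derivative f') (at x)"
    using has_derivative_transform_within_open[OF assms(2) open_U assms(1,3)] .
  then show ?thesis using has_derivative_unique[OF G_has_derivative[OF assms(1)]] by metis
qed

lemma dG_sym: "x \<in> U \<Longrightarrow> dG x u v z = dG x v u z"
  by (rule dG_unique[OF _ G_has_derivative]) (auto intro: sym)

lemma linear_dG: "x \<in> U \<Longrightarrow> linear (dG x u v)"
  using G_has_derivative has_derivative_linear by blast

lemma dG_add_left: "x \<in> U \<Longrightarrow> dG x (u + u') v z = dG x u v z + dG x u' v z"
  by (rule dG_unique[OF _ has_derivative_add[OF G_has_derivative G_has_derivative]])
    (auto simp: bilinear_ladd[OF bil])

lemma dG_scale_left: "x \<in> U \<Longrightarrow> dG x (c *\<^sub>R u) v z = c * dG x u v z"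
  by (rule dG_unique[OF _ has_derivative_mult_right[OF G_has_derivative]])
    (auto simp: bilinear_lmul[OF bil])

lemma dG_add_right: "x \<in> U \<Longrightarrow> dG x u (v + v') z = dG x u v z + dG x u v' z"
  using dG_add_left dG_sym by metis

lemma dG_scale_right: "x \<in> U \<Longrightarrow> dG x u (c *\<^sub>R v) z = c * dG x u v z"
  using dG_scale_left dG_sym by metis

lemmas dG_linear_simps = dG_add_left dG_scale_left dG_add_right dG_scale_right
  linear_add[OF linear_dG] linear_scale[OF linear_dG]

lemmas G_linear_simps = bilinear_ladd[OF bil] bilinear_radd[OF bil] bilinear_lmul[OF bil]
  bilinear_rmul[OF bil] bilinear_lsub[OF bil] bilinear_rsub[OF bil]

lemma G_eqI:
  assumes "x \<in> U" "\<And>z. G x w z = G x w' z"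
  shows "w = w'"
proof -
  have "w - w' = 0"
    using assms by (intro nondeg[OF assms(1)]) (simp add: G_linear_simps)
  then show ?thesis by simp
qed

lemma gamma_koszul:
  assumes "x \<in> U"
  shows "2 * G x (gamma x u v) z = dG x v z u + dG x u z v - dG x u v z"
proof -
  let ?\<omega> = "\<lambda>z. (dG x v z u + dG x u z v - dG x u v z) / 2"
  have "linear ?\<omega>"
    by (rule linearI) (simp_all add: dG_linear_simps assms algebra_simps add_divide_distrib diff_divide_distrib)
  then have "\<exists>!w. \<forall>z. G x w z = ?\<omega> z"
    using riesz_nondegenerate[OF bil[OF assms]] nondeg[OF assms] by blast
  then have "\<exists>!w. \<forall>z. 2 * G x w z = dG x v z u + dG x u z v - dG x u v z"
    by (simp add: eq_divide_eq mult.commute)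
  from theI'[OF this] show ?thesis unfolding gamma_def by blast
qed

lemma gammaI:
  assumes "x \<in> U" "\<And>z. 2 * G x w z = dG x v z u + dG x u z v - dG x u v z"
  shows "gamma x u v = w"
proof (rule G_eqI[OF assms(1)])
  show "G x (gamma x u v) z = G x w z" for z
    using gamma_koszul[OF assms(1), of u v z] assms(2)[of z] by simp
qed

lemma gamma_sym: "x \<in> U \<Longrightarrow> gamma x u v = gamma x v u"
  by (rule gammaI) (simp_all add: gamma_koszul dG_sym[of x u v])

lemma gamma_add_right: "x \<in> U \<Longrightarrow> gamma x u (v + v') = gamma x u v + gamma x u v'"
  by (rule gammaI) (simp_all add: G_linear_simps gamma_koszul dG_linear_simps distrib_left)

lemma gamma_scale_right: "x \<in> U \<Longrightarrow> gamma x u (c *\<^sub>R v) = c *\<^sub>R gamma x u v"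
  by (rule gammaI)
    (simp_all add: G_linear_simps gamma_koszul dG_linear_simps mult.left_commute[of 2]
      right_diff_distrib distrib_left)

lemma gamma_scale_left: "x \<in> U \<Longrightarrow> gamma x (c *\<^sub>R u) v = c *\<^sub>R gamma x u v"
  by (metis gamma_sym gamma_scale_right)

lemma metric_compatible:
  "x \<in> U \<Longrightarrow> dG x z w u = G x (gamma x u z) w + G x z (gamma x u w)"
  using gamma_koszul[of x u z w] gamma_koszul[of x u w z] sym[of x z "gamma x u w"]
    dG_sym[of x u z w] dG_sym[of x u w z] dG_sym[of x z w u] by simp

text \<open>By Cramer's rule the Christoffel symbols are rational functions of the coefficients of the metric
  and their first derivatives.\<close>

lemma gamma_differentiable:
  assumes "x \<in> U"
  shows "(\<lambda>y. gamma y u v) differentiable (at x)"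
proof -
  let ?b = "\<lambda>y. \<chi> i. (dG y v (axis i 1) u + dG y u (axis i 1) v - dG y u v (axis i 1)) / 2"
  let ?N = "\<lambda>y k. (\<chi> i j. if j = k then ?b y $ i else gram_matrix (G y) $ i $ j) :: real ^ 'n ^ 'n"
  let ?f = "\<lambda>y. \<Sum>k\<in>UNIV. (det (?N y k) / det (gram_matrix (G y))) *\<^sub>R (axis k 1 :: real ^ 'n)"
  have eq: "?f y = gamma y u v" if "y \<in> U" for y
  proof -
    have d: "det (gram_matrix (G y)) \<noteq> 0"
      using gram_matrix_det_nonzero[OF bil[OF that]] nondeg[OF that] by blast
    have "gram_matrix (G y) *v gamma y u v = ?b y"
      using gamma_koszul[OF that, of u v] by (simp add: vec_eq_iff gram_matrix_mult[OF bil[OF that]] mult.commute)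
    then have "gamma y u v = (\<chi> k. det (?N y k) / det (gram_matrix (G y)))"
      unfolding cramer[OF d] .
    then show ?thesis
      using linear_axis_expansion[OF linear_id, of "gamma y u v"] by simp
  qed
  have G: "(\<lambda>y. G y a b) differentiable (at x)" for a b
    using G_has_derivative[OF assms] differentiable_def by blast
  have dG: "(\<lambda>y. dG y a b c) differentiable (at x)" for a b c
    unfolding dG_def
    using differentiable_on_open_at[OF open_U
        smooth_on_differentiable_on[OF smooth_on_frechet_derivative[OF smooth]] assms] .
  have d0: "det (gram_matrix (G x)) \<noteq> 0"
    using gram_matrix_det_nonzero[OF bil[OF assms]] nondeg[OF assms] by blast
  have gram: "(\<lambda>y. gram_matrix (G y) $ i $ j) differentiable (at x)" for i j
    by (simp add: gram_matrix_def G)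
  have "(\<lambda>y. ?b y $ i) differentiable (at x)" for i
    using dG by (auto intro!: differentiable_divide differentiable_add differentiable_diff)
  then have "(\<lambda>y. ?N y k $ i $ j) differentiable (at x)" for i j k
    using gram by (cases "j = k") auto
  then have "(\<lambda>y. det (?N y k)) differentiable (at x)" for k
    by (rule differentiable_det)
  moreover have "(\<lambda>y. det (gram_matrix (G y))) differentiable (at x)"
    by (rule differentiable_det) (rule gram)
  ultimately have "?f differentiable (at x)"
    using d0 by (intro differentiable_sum differentiable_scaleR differentiable_divide) auto
  then obtain D where "(?f has_derivative D) (at x)" unfolding differentiable_def by blast
  from has_derivative_transform_within_open[OF this open_U assms eq] show ?thesis
    unfolding differentiable_def by blast
qed

lemma gamma_has_derivative:
  "x \<in> U \<Longrightarrow> ((\<lambda>y. gamma y u v) has_derivative dgamma x u v) (at x)"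
  using gamma_differentiable frechet_derivative_works unfolding dgamma_def[abs_def] by blast

lemma dgamma_unique:
  assumes "x \<in> U" "(f has_derivative f') (at x)" "\<And>y. y \<in> U \<Longrightarrow> f y = gamma y u v"
  shows "dgamma x u v z = f' z"
proof -
  have "((\<lambda>y. gamma y u v) has_derivative f') (at x)"
    using has_derivative_transform_within_open[OF assms(2) open_U assms(1,3)] .
  then show ?thesis using has_derivative_unique[OF gamma_has_derivative[OF assms(1)]] by metis
qed

lemma dgamma_sym: "x \<in> U \<Longrightarrow> dgamma x u v z = dgamma x v u z"
  by (rule dgamma_unique[OF _ gamma_has_derivative]) (auto intro: gamma_sym)

lemma dgamma_add_right: "x \<in> U \<Longrightarrow> dgamma x u (v + v') z = dgamma x u v z + dgamma x u v' z"
  by (rule dgamma_unique[OF _ has_derivative_add[OF gamma_has_derivative gamma_has_derivative]])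
    (auto simp: gamma_add_right)

lemma dgamma_scale_right: "x \<in> U \<Longrightarrow> dgamma x u (c *\<^sub>R v) z = c *\<^sub>R dgamma x u v z"
  by (rule dgamma_unique[OF _ has_derivative_scaleR_right[OF gamma_has_derivative]])
    (auto simp: gamma_scale_right)

lemmas gamma_linear_simps = gamma_add_right gamma_scale_right dgamma_add_right dgamma_scale_right

lemma linear_Rm3: "x \<in> U \<Longrightarrow> linear (\<lambda>w. Rm x u v w)"
  by (rule linearI) (simp_all add: Rm_def gamma_linear_simps algebra_simps)

lemma first_Bianchi: "x \<in> U \<Longrightarrow> Rm x u v w - Rm x u w v = Rm x w v u"
  by (simp add: Rm_def gamma_sym[of x w] gamma_sym[of x v u] dgamma_sym[of x w] dgamma_sym[of x v u])

lemma G_moving_has_derivative: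
  assumes "x \<in> U" "(h has_derivative h') (at x)"
  shows "((\<lambda>y. G y (h y) w) has_derivative (\<lambda>v. dG x (h x) w v + G x (h' v) w)) (at x)"
proof -
  have lin: "linear (\<lambda>u. dG x u w v)" for v
    by (rule linearI) (simp_all add: dG_linear_simps assms)
  have "((\<lambda>y. \<Sum>k\<in>UNIV. h y $ k *\<^sub>R G y (axis k 1) w) has_derivative
      (\<lambda>v. \<Sum>k\<in>UNIV. h x $ k *\<^sub>R dG x (axis k 1) w v + h' v $ k *\<^sub>R G x (axis k 1) w)) (at x)"
    using assms by (intro has_derivative_sum has_derivative_scaleR G_has_derivative
        bounded_linear.has_derivative[OF bounded_linear_vec_nth])
  moreover have "(\<Sum>k\<in>UNIV. h x $ k *\<^sub>R dG x (axis k 1) w v + h' v $ k *\<^sub>R G x (axis k 1) w)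
      = dG x (h x) w v + G x (h' v) w" for v
    using linear_axis_expansion[OF lin, of "h x" v]
      linear_axis_expansion[OF bilinear_left_linear[OF bil[OF assms(1)]], of "h' v" w]
    by (simp add: sum.distrib)
  ultimately have "((\<lambda>y. \<Sum>k\<in>UNIV. h y $ k *\<^sub>R G y (axis k 1) w) has_derivative
      (\<lambda>v. dG x (h x) w v + G x (h' v) w)) (at x)" by simp
  then show ?thesis
    by (rule has_derivative_transform_within_open[OF _ open_U assms(1)])
      (rule linear_axis_expansion[OF bilinear_left_linear[OF bil], symmetric])
qed

text \<open>Skew-symmetry of the curvature operators: differentiate metric compatibility once more and use the
  symmetry of the second derivatives of the metric.\<close>

lemma Rm_skew:
  assumes x: "x \<in> U"
  shows "G x (Rm x u v z) w + G x z (Rm x u v w) = 0"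
proof -
  have H: "frechet_derivative (\<lambda>y. frechet_derivative (\<lambda>y. G y z w) (at y) u) (at x) v
      = G x (gamma x v (gamma x u z)) w + G x (gamma x u z) (gamma x v w) + G x (dgamma x u z v) w
      + (G x (gamma x v (gamma x u w)) z + G x (gamma x u w) (gamma x v z) + G x (dgamma x u w v) z)"
    for u v
  proof -
    have d: "((\<lambda>y. G y (gamma y u z) w + G y (gamma y u w) z) has_derivative
        (\<lambda>v. (dG x (gamma x u z) w v + G x (dgamma x u z v) w)
           + (dG x (gamma x u w) z v + G x (dgamma x u w v) z))) (at x)"
      using x by (intro has_derivative_add G_moving_has_derivative gamma_has_derivative)
    have "G y (gamma y u z) w + G y (gamma y u w) z
        = frechet_derivative (\<lambda>y. G y z w) (at y) u" if "y \<in> U" for y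
      using metric_compatible[OF that, of z w u] sym[OF that, of z] by (simp add: dG_def)
    from has_derivative_transform_within_open[OF d open_U x this]
    have "((\<lambda>y. frechet_derivative (\<lambda>y. G y z w) (at y) u) has_derivative
        (\<lambda>v. (dG x (gamma x u z) w v + G x (dgamma x u z v) w)
           + (dG x (gamma x u w) z v + G x (dgamma x u w v) z))) (at x)" .
    from frechet_derivative_at[OF this, symmetric] show ?thesis
      by (simp add: metric_compatible[OF x])
  qed
  show ?thesis
    using second_derivative_symmetric[OF open_U x smooth, of z w u v]
      sym[OF x, of z "Rm x u v w"]
      sym[OF x, of "gamma x u z" "gamma x v w"] sym[OF x, of "gamma x u w" "gamma x v z"]
    unfolding H by (simp add: Rm_def G_linear_simps[OF x])
qed

text \<open>By the first Bianchi identity the antisymmetric part of the Ricci tensor is the trace of a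
  curvature operator, which is skew.\<close>

lemma coordinate_ricci_symmetric:
  assumes "x \<in> U"
  shows "trace (matrix (\<lambda>u. Rm x u v w)) = trace (matrix (\<lambda>u. Rm x u w v))"
proof -
  have "trace (matrix (Rm x w v)) = 0"
  proof (rule trace_skew_eq_0[where B = "G x"])
    show "u = 0" if "\<And>v. G x u v = 0" for u using nondeg[OF assms that] .
  qed (rule bil sym linear_Rm3 Rm_skew assms)+
  moreover have "(Rm x u v w) $ i - (Rm x u w v) $ i = Rm x w v u $ i" for u i
    using arg_cong[OF first_Bianchi[OF assms, of u v w], of "\<lambda>z. z $ i"] by simp
  then have "trace (matrix (\<lambda>u. Rm x u v w)) - trace (matrix (\<lambda>u. Rm x u w v))
      = trace (matrix (Rm x w v))"
    unfolding trace_matrix sum_subtractf[symmetric] by (rule sum.cong[OF refl])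
  ultimately show ?thesis by simp
qed

end

section \<open>Charts and tangent spaces\<close>

lemma coords_Tangent_Vector [simp]: "coords (Tangent_Vector f) = f"
  by (simp add: Tangent_Vector_inverse)

lemma coords_zero [simp]: "coords 0 c = 0"
  by (simp add: zero_tangent_vector_def)

lemma coords_add [simp]: "coords (X + Y) c = coords X c + coords Y c"
  by (simp add: plus_tangent_vector_def)

lemma coords_scaleR [simp]: "coords (t *\<^sub>R X) c = t *\<^sub>R coords X c"
  by (simp add: scaleR_tangent_vector_def)

lemma tangent_vector_eqI: "(\<And>c. coords X c = coords Y c) \<Longrightarrow> X = Y"
  by (rule coords_inject[THEN iffD1]) (rule ext)

context smooth_manifold
begin

lemma chart_subset: "c \<in> A \<Longrightarrow> fst c \<subseteq> topspace M"
  using chart_domain openin_subset by blast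

lemma chart_inj: "c \<in> A \<Longrightarrow> inj_on (snd c) (fst c)"
  using homeomorphic_imp_injective_map[OF chart_homeo] chart_subset
  by (simp add: topspace_subtopology Int_absorb1)

lemma chart_inv_chart: "c \<in> A \<Longrightarrow> q \<in> fst c \<Longrightarrow> chart_inv c (snd c q) = q"
  by (simp add: chart_inv_def chart_inj)

lemma chart_chart_inv: "x \<in> snd c ` fst c \<Longrightarrow> snd c (chart_inv c x) = x"
  by (simp add: chart_inv_def f_inv_into_f)

lemma chart_inv_in: "x \<in> snd c ` fst c \<Longrightarrow> chart_inv c x \<in> fst c"
  by (simp add: chart_inv_def inv_into_into)

lemma chart_open_image:
  assumes "c \<in> A" "openin M W" "W \<subseteq> fst c"
  shows "open (snd c ` W)"
proof -
  have "openin (subtopology M (fst c)) W"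
    using assms chart_domain by (simp add: openin_open_subtopology)
  then have "openin (top_of_set (snd c ` fst c)) (snd c ` W)"
    using homeomorphic_imp_open_map[OF chart_homeo[OF assms(1)]] by (simp add: open_map_def)
  then show ?thesis using chart_image[OF assms(1)] openin_open_eq by blast
qed

lemma open_overlap: "c \<in> A \<Longrightarrow> d \<in> A \<Longrightarrow> open (snd c ` (fst c \<inter> fst d))"
  by (rule chart_open_image) (auto intro: chart_domain)

lemma transition_apply: "c \<in> A \<Longrightarrow> q \<in> fst c \<Longrightarrow> transition c d (snd c q) = snd d q"
  by (simp add: transition_def chart_inv_chart)

lemma transition_has_derivative:
  assumes "c \<in> A" "d \<in> A" "q \<in> fst c" "q \<in> fst d"
  shows "(transition c d has_derivative frechet_derivative (transition c d) (at (snd c q))) (at (snd c q))"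
  using assms
  by (intro has_derivative_frechet[OF open_overlap smooth_on_differentiable_on[OF charts_compatible]]) auto

lemma transition_cocycle:
  assumes "c \<in> A" "d \<in> A" "e \<in> A" "q \<in> fst c" "q \<in> fst d" "q \<in> fst e"
  shows "frechet_derivative (transition c e) (at (snd c q)) u
       = frechet_derivative (transition d e) (at (snd d q))
           (frechet_derivative (transition c d) (at (snd c q)) u)"
proof -
  have "((\<lambda>x. transition d e (transition c d x)) has_derivative
      (\<lambda>u. frechet_derivative (transition d e) (at (snd d q))
           (frechet_derivative (transition c d) (at (snd c q)) u))) (at (snd c q))"
    by (rule has_derivative_compose[where f = "transition c d" and g = "transition d e"])
      (use assms transition_has_derivative transition_apply in auto)
  then have "(transition c e has_derivative
      (\<lambda>u. frechet_derivative (transition d e) (at (snd d q))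
           (frechet_derivative (transition c d) (at (snd c q)) u))) (at (snd c q))"
    by (rule has_derivative_transform_within_open[OF _ open_overlap[OF assms(1,2)]])
      (use assms in \<open>auto simp: transition_apply\<close>)
  from frechet_derivative_at[OF this, symmetric] show ?thesis by simp
qed

lemma transition_same_derivative:
  assumes "c \<in> A" "q \<in> fst c"
  shows "frechet_derivative (transition c c) (at (snd c q)) u = u"
proof -
  have "(transition c c has_derivative (\<lambda>u. u)) (at (snd c q))"
    by (rule has_derivative_transform_within_open[OF has_derivative_ident chart_image[OF assms(1)]])
      (use assms in \<open>auto simp: transition_apply\<close>)
  from frechet_derivative_at[OF this, symmetric] show ?thesis by simp
qed

lemma coords_from_coords:
  "c \<in> A \<Longrightarrow> q \<in> fst c \<Longrightarrow> coords (from_coords A c q u) c = u"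
  by (simp add: from_coords_def transition_same_derivative)

lemma from_coords_tangent:
  assumes "c \<in> A" "q \<in> fst c"
  shows "from_coords A c q u \<in> tangent_space A q"
  unfolding tangent_space_def mem_Collect_eq
proof (intro conjI ballI impI allI)
  fix d e assume "d \<in> A" "e \<in> A" "q \<in> fst d \<and> q \<in> fst e"
  then show "coords (from_coords A c q u) e
      = frechet_derivative (transition d e) (at (snd d q)) (coords (from_coords A c q u) d)"
    using transition_cocycle[of c d e q u] assms by (simp add: from_coords_def)
qed (auto simp: from_coords_def)

lemma from_coords_coords:
  assumes "c \<in> A" "q \<in> fst c" "X \<in> tangent_space A q"
  shows "from_coords A c q (coords X c) = X"
proof (rule tangent_vector_eqI)
  fix d
  show "coords (from_coords A c q (coords X c)) d = coords X d"
  proof (cases "d \<in> A \<and> q \<in> fst d")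
    case True
    then have "coords X d = frechet_derivative (transition c d) (at (snd c q)) (coords X c)"
      using assms unfolding tangent_space_def by blast
    then show ?thesis using True by (simp add: from_coords_def)
  next
    case False
    then have "coords X d = 0"
      using assms unfolding tangent_space_def by blast
    then show ?thesis using False by (auto simp: from_coords_def)
  qed
qed

lemma linear_from_coords:
  assumes "c \<in> A" "q \<in> fst c"
  shows "linear (from_coords A c q)"
proof (rule linearI)
  have lin: "linear (frechet_derivative (transition c d) (at (snd c q)))" if "d \<in> A" "q \<in> fst d" for d
    using transition_has_derivative assms that has_derivative_linear by blast
  show "from_coords A c q (u + v) = from_coords A c q u + from_coords A c q v" for u v
    by (rule tangent_vector_eqI) (simp add: from_coords_def linear_add[OF lin])
  show "from_coords A c q (t *\<^sub>R u) = t *\<^sub>R from_coords A c q u" for t u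
    by (rule tangent_vector_eqI) (simp add: from_coords_def linear_scale[OF lin])
qed

lemma tangent_space_eq_range:
  assumes "c \<in> A" "q \<in> fst c"
  shows "tangent_space A q = range (from_coords A c q)"
proof (intro equalityI subsetI)
  show "X \<in> range (from_coords A c q)" if "X \<in> tangent_space A q" for X
    using from_coords_coords[OF assms that] by (metis rangeI)
  show "X \<in> tangent_space A q" if "X \<in> range (from_coords A c q)" for X
    using that from_coords_tangent[OF assms] by blast
qed

lemma chart_around: "p \<in> topspace M \<Longrightarrow> \<exists>c\<in>A. p \<in> fst c"
  using charts_cover by auto

lemma chart_at: "p \<in> topspace M \<Longrightarrow> chart_at A p \<in> A \<and> p \<in> fst (chart_at A p)"
  unfolding chart_at_def by (rule someI_ex) (use chart_around in blast)

lemma subspace_tangent_space: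
  assumes "p \<in> topspace M"
  shows "subspace (tangent_space A p)"
proof -
  have c: "chart_at A p \<in> A" "p \<in> fst (chart_at A p)" using chart_at[OF assms] by auto
  show ?thesis unfolding tangent_space_eq_range[OF c]
    by (rule linear_subspace_image[OF linear_from_coords[OF c] subspace_UNIV])
qed

text \<open>A tangent vector is first extended with constant coordinates over a chart and then cut off by a
  bump function. Extension by zero is smooth because the support of the bump function is compact,
  hence closed in the Hausdorff space \<open>M\<close>.\<close>

lemma extend_tangent_vector:
  assumes p: "p \<in> topspace M" and v: "v \<in> tangent_space A p"
  shows "\<exists>X. smooth_vector_field M A X \<and> X p = v"
proof -
  obtain c where c: "c \<in> A" "p \<in> fst c" using chart_around[OF p] by blast
  obtain e where e: "e > 0" "cball (snd c p) e \<subseteq> snd c ` fst c"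
    using chart_image[OF c(1)] c(2) open_contains_cball by blast
  obtain \<psi> :: "real ^ 'n \<Rightarrow> real" where \<psi>: "smooth_on UNIV \<psi>" "\<psi> (snd c p) = 1"
    "\<And>x. x \<notin> cball (snd c p) e \<Longrightarrow> \<psi> x = 0"
    using smooth_bump_exists[OF e(1)] by blast
  define u where "u = coords v c"
  define X where "X = (\<lambda>q. if q \<in> fst c then \<psi> (snd c q) *\<^sub>R from_coords A c q u else 0)"
  define K where "K = chart_inv c ` cball (snd c p) e"
  have K: "K \<subseteq> fst c" 
    unfolding K_def by (intro image_subsetI chart_inv_in subsetD[OF e(2)])
  have "snd c ` K = cball (snd c p) e"
  proof -
    have "(\<lambda>x. snd c (chart_inv c x)) ` cball (snd c p) e = (\<lambda>x. x) ` cball (snd c p) e"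
      by (rule image_cong[OF refl]) (rule chart_chart_inv[OF subsetD[OF e(2)]])
    then show ?thesis unfolding K_def image_image by simp
  qed
  moreover have "compactin (top_of_set (snd c ` fst c)) (cball (snd c p) e)"
    using e by (simp add: compactin_subtopology)
  ultimately have "compactin (subtopology M (fst c)) K"
    using homeomorphic_map_compactness[OF chart_homeo[OF c(1)], of K] K chart_subset[OF c(1)]
    by (simp add: topspace_subtopology Int_absorb1)
  then have "closedin M K"
    using compactin_imp_closedin[OF hausdorff] by (simp add: compactin_subtopology)
  then have open_away: "openin M (fst d - K)" if "d \<in> A" for d
    using chart_domain[OF that] by (simp add: openin_diff)
  have "Ck_on k (snd d ` fst d) (\<lambda>y. coords (X (chart_inv d y)) d)" if d: "d \<in> A" for d k
  proof (rule Ck_on_local)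
    fix y assume y: "y \<in> snd d ` fst d"
    show "\<exists>T. open T \<and> y \<in> T \<and> Ck_on k T (\<lambda>y. coords (X (chart_inv d y)) d)"
    proof (cases "chart_inv d y \<in> fst c")
      case True
      let ?T = "snd d ` (fst d \<inter> fst c)" and ?S = "snd c ` (fst c \<inter> fst d)"
      have T: "open ?T" and S: "open ?S" using open_overlap c d by blast+
      have tr: "Ck_on k ?T (transition d c)"
        using charts_compatible[OF d c(1)] by (simp add: smooth_on_def)
      have im: "transition d c ` ?T \<subseteq> ?S" using transition_apply[OF d, of _ c] by fastforce
      have 1: "Ck_on k ?T (\<lambda>y. \<psi> (transition d c y))"
        using \<psi>(1) by (intro Ck_on_compose[OF T open_UNIV _ _ tr]) (auto simp: smooth_on_def)
      have 2: "Ck_on k ?T (\<lambda>y. frechet_derivative (transition c d) (at (transition d c y)) u)"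
        using smooth_on_frechet_derivative[OF charts_compatible[OF c(1) d], of u]
        by (intro Ck_on_compose[OF T S im _ tr]) (simp add: smooth_on_def)
      have "Ck_on k ?T (\<lambda>y. coords (X (chart_inv d y)) d)"
        by (rule Ck_on_cong[OF T _ Ck_on_scaleR[OF T 1 2]])
          (use d in \<open>auto simp: X_def from_coords_def transition_apply chart_inv_chart\<close>)
      moreover have "y \<in> ?T" using y True chart_chart_inv chart_inv_in by (metis IntI image_eqI)
      ultimately show ?thesis using T by blast
    next
      case False
      let ?T = "snd d ` (fst d - K)"
      have T: "open ?T" by (rule chart_open_image[OF d open_away[OF d]]) auto
      have "coords (X q) d = 0" if "q \<in> fst d - K" for q
      proof (cases "q \<in> fst c")
        case True
        then have "snd c q \<notin> cball (snd c p) e"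
          using that chart_inv_chart[OF c(1) True] unfolding K_def by (metis DiffD2 image_eqI)
        then show ?thesis by (simp add: X_def \<psi>(3))
      qed (simp add: X_def)
      then have "Ck_on k ?T (\<lambda>y. coords (X (chart_inv d y)) d)"
        by (intro Ck_on_cong[OF T _ Ck_on_const[of k ?T 0]]) (auto simp: chart_inv_chart[OF d])
      moreover have "y \<in> ?T"
        using y False K chart_chart_inv chart_inv_in by (metis Diff_iff image_eqI subsetD)
      ultimately show ?thesis using T by blast
    qed
  qed
  moreover have "X q \<in> tangent_space A q" if "q \<in> topspace M" for q
    using subspace_tangent_space[OF that] from_coords_tangent[OF c(1), of q]
    by (simp add: X_def subspace_0 subspace_scale)
  moreover have "X p = v"
    using c v by (simp add: X_def \<psi>(2) u_def from_coords_coords)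
  ultimately show ?thesis
    unfolding smooth_vector_field_def smooth_on_def by blast
qed

end

section \<open>Ricci tensor and Ricci operator of a semi-Riemannian manifold\<close>

context semi_riemannian_manifold
begin

lemma metric_add_right:
  assumes "p \<in> topspace M" "X \<in> tangent_space A p" "Y \<in> tangent_space A p" "Z \<in> tangent_space A p"
  shows "g p Z (X + Y) = g p Z X + g p Z Y"
proof -
  have "X + Y \<in> tangent_space A p"
    using assms subspace_tangent_space by (simp add: subspace_add)
  then show ?thesis
    using assms metric_add metric_sym by metis
qed

lemma metric_scaleR_right:
  assumes "p \<in> topspace M" "X \<in> tangent_space A p" "Y \<in> tangent_space A p"
  shows "g p Y (t *\<^sub>R X) = t * g p Y X"
proof -
  have "t *\<^sub>R X \<in> tangent_space A p"
    using assms subspace_tangent_space by (simp add: subspace_scale)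
  then show ?thesis
    using assms metric_scaleR metric_sym by metis
qed

lemma coordinate_metric_chart:
  assumes c: "c \<in> A"
  shows "coordinate_metric (snd c ` fst c) (local_metric A g c)"
proof
  show "open (snd c ` fst c)" by (rule chart_image[OF c])
  fix x assume x: "x \<in> snd c ` fst c"
  let ?q = "chart_inv c x"
  have q: "?q \<in> fst c" "?q \<in> topspace M" using chart_inv_in[OF x] chart_subset[OF c] by auto
  note tan = from_coords_tangent[OF c q(1)]
  note lin = linear_add[OF linear_from_coords[OF c q(1)]] linear_scale[OF linear_from_coords[OF c q(1)]]
  show "bilinear (local_metric A g c x)"
    unfolding bilinear_def local_metric_def
    by (intro conjI allI linearI)
      (simp_all add: lin tan q metric_add metric_add_right metric_scaleR metric_scaleR_right)
  show "local_metric A g c x u v = local_metric A g c x v u" for u v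
    unfolding local_metric_def by (rule metric_sym[OF q(2) tan tan])
  show "u = 0" if "\<And>v. local_metric A g c x u v = 0" for u
  proof -
    have "from_coords A c ?q u = 0"
    proof (rule metric_nondegenerate[OF q(2) tan])
      fix Y assume "Y \<in> tangent_space A ?q"
      then show "g ?q (from_coords A c ?q u) Y = 0"
        using that[of "coords Y c"] from_coords_coords[OF c q(1)] by (simp add: local_metric_def)
    qed
    then show ?thesis using coords_from_coords[OF c q(1), of u] by simp
  qed
next
  show "smooth_on (snd c ` fst c) (\<lambda>x. local_metric A g c x u v)" for u v
    by (rule metric_smooth[OF c])
qed

lemma local_curvature_eq_Rm:
  assumes c: "c \<in> A" and x: "x \<in> snd c ` fst c"
  shows "local_curvature A g c (\<lambda>_. u) (\<lambda>_. v) (\<lambda>_. w) x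
       = coordinate_metric.Rm (local_metric A g c) x u v w"
proof -
  interpret C: coordinate_metric "snd c ` fst c" "local_metric A g c"
    by (rule coordinate_metric_chart[OF c])
  have gamma: "christoffel A g c x u v = C.gamma x u v" for x u v
    by (simp add: christoffel_def C.gamma_def C.dG_def)
  have nabla: "local_nabla A g c (\<lambda>_. u) (\<lambda>_. v) = (\<lambda>x. C.gamma x u v)" for u v
    by (rule ext) (simp add: local_nabla_def gamma)
  have "C.gamma x 0 w = 0" using C.gamma_scale_left[OF x, of 0 0 w] by simp
  moreover have "local_bracket (\<lambda>_. u) (\<lambda>_. v) = (\<lambda>_. 0)"
    by (rule ext) (simp add: local_bracket_def)
  ultimately show ?thesis
    by (simp add: local_curvature_def nabla C.Rm_def)
      (simp add: local_nabla_def gamma C.dgamma_def)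
qed

lemma ricci_coordinates:
  assumes "p \<in> topspace M"
  shows "ricci A g p Y Z = trace (matrix (\<lambda>u. coordinate_metric.Rm (local_metric A g (chart_at A p))
    (snd (chart_at A p) p) u (coords Y (chart_at A p)) (coords Z (chart_at A p))))"
  using chart_at[OF assms]
  by (simp add: ricci_def tangent_trace_def curvature_def Let_def coords_from_coords
      local_curvature_eq_Rm)

lemma ricci_sym:
  assumes "p \<in> topspace M"
  shows "ricci A g p Y Z = ricci A g p Z Y"
proof -
  interpret C: coordinate_metric "snd (chart_at A p) ` fst (chart_at A p)" "local_metric A g (chart_at A p)"
    using coordinate_metric_chart chart_at[OF assms] by blast
  show ?thesis
    unfolding ricci_coordinates[OF assms]
    by (rule C.coordinate_ricci_symmetric) (use chart_at[OF assms] in blast)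
qed

lemma linear_ricci:
  assumes "p \<in> topspace M"
  shows "linear (ricci A g p Y)"
proof -
  interpret C: coordinate_metric "snd (chart_at A p) ` fst (chart_at A p)" "local_metric A g (chart_at A p)"
    using coordinate_metric_chart chart_at[OF assms] by blast
  have x: "snd (chart_at A p) p \<in> snd (chart_at A p) ` fst (chart_at A p)"
    using chart_at[OF assms] by blast
  show ?thesis
    by (rule linearI)
      (simp_all add: ricci_coordinates[OF assms] trace_matrix linear_add[OF C.linear_Rm3[OF x]]
        linear_scale[OF C.linear_Rm3[OF x]] sum.distrib sum_distrib_left)
qed

lemma ricci_operator_ex1:
  assumes p: "p \<in> topspace M"
  shows "\<exists>!W. W \<in> tangent_space A p \<and> (\<forall>Y\<in>tangent_space A p. g p W Y = ricci A g p X Y)"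
proof -
  let ?c = "chart_at A p"
  have c: "?c \<in> A" "p \<in> fst ?c" using chart_at[OF p] by auto
  interpret C: coordinate_metric "snd ?c ` fst ?c" "local_metric A g ?c"
    by (rule coordinate_metric_chart[OF c(1)])
  have x: "snd ?c p \<in> snd ?c ` fst ?c" using c by blast
  have G: "local_metric A g ?c (snd ?c p) u v = g p (from_coords A ?c p u) (from_coords A ?c p v)" for u v
    by (simp add: local_metric_def chart_inv_chart c)
  have "linear (\<lambda>v. ricci A g p X (from_coords A ?c p v))"
    using linear_compose[OF linear_from_coords[OF c] linear_ricci[OF p, of X]] by (simp add: o_def)
  then have "\<exists>!w. \<forall>z. local_metric A g ?c (snd ?c p) w z = ricci A g p X (from_coords A ?c p z)"
    using riesz_nondegenerate[OF C.bil[OF x] C.nondeg[OF x]] by blast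
  then obtain w where "\<And>z. g p (from_coords A ?c p w) (from_coords A ?c p z)
      = ricci A g p X (from_coords A ?c p z)"
    unfolding G by blast
  then have w: "\<forall>Y\<in>tangent_space A p. g p (from_coords A ?c p w) Y = ricci A g p X Y"
    using tangent_space_eq_range[OF c] by auto
  have "W = from_coords A ?c p w" (is "_ = ?w")
    if W: "W \<in> tangent_space A p" "\<forall>Y\<in>tangent_space A p. g p W Y = ricci A g p X Y" for W
  proof -
    have w_in: "?w \<in> tangent_space A p" by (rule from_coords_tangent[OF c])
    then have neg: "(-1) *\<^sub>R ?w \<in> tangent_space A p"
      using subspace_tangent_space[OF p] by (rule subspace_scale[rotated])
    then have "W + (-1) *\<^sub>R ?w \<in> tangent_space A p"
      by (intro subspace_add[OF subspace_tangent_space[OF p] W(1) neg])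
    then have "W + (-1) *\<^sub>R ?w = 0"
    proof (rule metric_nondegenerate[OF p])
      fix Y assume Y: "Y \<in> tangent_space A p"
      then show "g p (W + (-1) *\<^sub>R ?w) Y = 0"
        unfolding metric_add[OF p W(1) neg Y] metric_scaleR[OF p w_in Y] using W(2) w by simp
    qed
    then show ?thesis by simp
  qed
  then show ?thesis using w from_coords_tangent[OF c] by blast
qed

lemma ricci_operator_in: "p \<in> topspace M \<Longrightarrow> ricci_operator A g p X \<in> tangent_space A p"
  and metric_ricci_operator: "p \<in> topspace M \<Longrightarrow> Y \<in> tangent_space A p \<Longrightarrow>
    g p (ricci_operator A g p X) Y = ricci A g p X Y"
  using theI'[OF ricci_operator_ex1] unfolding ricci_operator_def by blast+

lemma ricci_operator_eqI:
  assumes "p \<in> topspace M" "W \<in> tangent_space A p"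
    "\<And>Y. Y \<in> tangent_space A p \<Longrightarrow> g p W Y = ricci A g p X Y"
  shows "ricci_operator A g p X = W"
  using ricci_operator_ex1[OF assms(1), of X] assms ricci_operator_in metric_ricci_operator by blast

text \<open>The trace of \<open>\<alpha> I + \<omega> \<otimes> Y\<close>.\<close>

lemma tangent_trace_scalar_plus_rank_one:
  assumes p: "p \<in> topspace M" and Y: "Y \<in> tangent_space A p"
    and F: "\<And>X. X \<in> tangent_space A p \<Longrightarrow> F X = \<alpha> *\<^sub>R X + \<omega> X *\<^sub>R Y"
    and add: "\<And>X X'. X \<in> tangent_space A p \<Longrightarrow> X' \<in> tangent_space A p \<Longrightarrow> \<omega> (X + X') = \<omega> X + \<omega> X'"
    and scale: "\<And>t X. X \<in> tangent_space A p \<Longrightarrow> \<omega> (t *\<^sub>R X) = t * \<omega> X"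
  shows "tangent_trace A p F = real CARD('n) * \<alpha> + \<omega> Y"
proof -
  let ?c = "chart_at A p"
  have c: "?c \<in> A" "p \<in> fst ?c" using chart_at[OF p] by auto
  note tan = from_coords_tangent[OF c]
  have lin: "linear (\<lambda>u. \<omega> (from_coords A ?c p u))"
    by (rule linearI) (simp_all add: linear_add[OF linear_from_coords[OF c]]
        linear_scale[OF linear_from_coords[OF c]] add scale tan)
  have "tangent_trace A p F = (\<Sum>i\<in>UNIV. \<alpha> + coords Y ?c $ i * \<omega> (from_coords A ?c p (axis i 1)))"
    by (simp add: tangent_trace_def Let_def trace_matrix F tan coords_from_coords[OF c] axis_def mult.commute)
  also have "\<dots> = real CARD('n) * \<alpha> + \<omega> (from_coords A ?c p (coords Y ?c))"
    using linear_axis_expansion[OF lin, of "coords Y ?c"] by (simp add: sum.distrib)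
  finally show ?thesis using from_coords_coords[OF c Y] by simp
qed

end

section \<open>Flatness in the direction of a unit field in the nullity distribution\<close>

context N_xi_manifold
begin

lemma xi_tangent: "p \<in> topspace M \<Longrightarrow> \<xi> p \<in> tangent_space A p"
  using xi_nullity by (simp add: nullity_distribution_def)

lemma ricci_xi:
  assumes p: "p \<in> topspace M" and Y: "Y \<in> tangent_space A p"
  shows "ricci A g p Y (\<xi> p) = k * (real CARD('n) - 1) * g p Y (\<xi> p)"
proof -
  have "tangent_trace A p (\<lambda>X. curvature A g p X Y (\<xi> p))
      = real CARD('n) * (k * g p Y (\<xi> p)) + - k * g p Y (\<xi> p)"
  proof (rule tangent_trace_scalar_plus_rank_one[OF p Y])
    show "curvature A g p X Y (\<xi> p) = (k * g p Y (\<xi> p)) *\<^sub>R X + (- k * g p X (\<xi> p)) *\<^sub>R Y"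
      if "X \<in> tangent_space A p" for X
      using xi_nullity[OF p] that Y by (simp add: nullity_distribution_def scaleR_diff_right)
  qed (simp_all add: metric_add metric_scaleR p xi_tangent algebra_simps)
  then show ?thesis by (simp add: ricci_def algebra_simps)
qed

lemma ricci_operator_xi:
  assumes p: "p \<in> topspace M"
  shows "ricci_operator A g p (\<xi> p) = (k * (real CARD('n) - 1)) *\<^sub>R \<xi> p"
proof (rule ricci_operator_eqI[OF p])
  show "(k * (real CARD('n) - 1)) *\<^sub>R \<xi> p \<in> tangent_space A p"
    using xi_tangent[OF p] subspace_tangent_space[OF p] by (simp add: subspace_scale)
  show "g p ((k * (real CARD('n) - 1)) *\<^sub>R \<xi> p) Y = ricci A g p (\<xi> p) Y"
    if Y: "Y \<in> tangent_space A p" for Y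
    using ricci_xi[OF p Y] ricci_sym[OF p] metric_sym[OF p Y xi_tangent[OF p]]
    by (simp add: metric_scaleR p xi_tangent Y)
qed

text \<open>Flatness is stated for global vector fields; the tensor at \<open>p\<close> depends on their values at \<open>p\<close>
  only.\<close>

lemma xi_T_flat_pointwise:
  assumes "xi_T_flat M A g a \<xi>" "p \<in> topspace M" "X \<in> tangent_space A p" "Y \<in> tangent_space A p"
  shows "T_curvature A g a p X Y (\<xi> p) = 0"
proof -
  obtain X' Y' where "smooth_vector_field M A X'" "X' p = X" "smooth_vector_field M A Y'" "Y' p = Y"
    using extend_tangent_vector assms by metis
  then show ?thesis using assms unfolding xi_T_flat_def by metis
qed

text \<open>The vanishing of the tensor with \<open>\<xi>\<close> in the second and third slots.\<close>

lemma xi_T_flat_equation: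
  assumes flat: "xi_T_flat M A g a \<xi>" and p: "p \<in> topspace M" and X: "X \<in> tangent_space A p"
  defines "n \<equiv> real CARD('n)" and "r \<equiv> scalar_curvature A g p"
  shows "(\<epsilon> * (k * a 0 + k * (n - 1) * a 1 + a 7 * r)) *\<^sub>R X
    + (g p X (\<xi> p) * ((n - 1) * k * (a 2 + a 3 + a 5 + a 6) - k * a 0 - a 7 * r)) *\<^sub>R \<xi> p
    + (a 4 * \<epsilon>) *\<^sub>R ricci_operator A g p X = 0"
proof -
  note xi = xi_tangent[OF p]
  have curv: "curvature A g p X (\<xi> p) (\<xi> p) = k *\<^sub>R (\<epsilon> *\<^sub>R X - g p X (\<xi> p) *\<^sub>R \<xi> p)"
    using xi_nullity[OF p] X xi xi_unit[OF p] by (simp add: nullity_distribution_def)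
  have "T_curvature A g a p X (\<xi> p) (\<xi> p) = 0"
    by (rule xi_T_flat_pointwise[OF flat p X xi])
  then show ?thesis
    unfolding T_curvature_def curv ricci_xi[OF p X] ricci_xi[OF p xi] xi_unit[OF p] ricci_operator_xi[OF p]
      n_def[symmetric] r_def[symmetric]
    by (simp add: algebra_simps)
qed

text \<open>If \<open>a 4\<close> is nonzero, the equation determines the Ricci operator.\<close>

lemma xi_T_flat_ricci_operator:
  assumes flat: "xi_T_flat M A g a \<xi>" and p: "p \<in> topspace M" and X: "X \<in> tangent_space A p"
    and a4: "a 4 \<noteq> 0"
  defines "n \<equiv> real CARD('n)" and "r \<equiv> scalar_curvature A g p"
  shows "ricci_operator A g p X = (- (k * a 0 + k * (n - 1) * a 1 + a 7 * r) / a 4) *\<^sub>R X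
    + ((k * a 0 - (n - 1) * k * (a 2 + a 3 + a 5 + a 6) + a 7 * r) / (\<epsilon> * a 4) * g p X (\<xi> p)) *\<^sub>R \<xi> p"
    (is "?Q = ?c *\<^sub>R X + ?d *\<^sub>R \<xi> p")
proof -
  let ?C = "\<epsilon> * (k * a 0 + k * (n - 1) * a 1 + a 7 * r)"
  let ?E = "g p X (\<xi> p) * ((n - 1) * k * (a 2 + a 3 + a 5 + a 6) - k * a 0 - a 7 * r)"
  have e: "a 4 * \<epsilon> \<noteq> 0" "\<epsilon> \<noteq> 0" using a4 epsilon by auto
  have "?C *\<^sub>R X + ?E *\<^sub>R \<xi> p + (a 4 * \<epsilon>) *\<^sub>R ?Q = 0"
    using xi_T_flat_equation[OF flat p X] unfolding n_def r_def .
  then have "inverse (a 4 * \<epsilon>) *\<^sub>R (?C *\<^sub>R X + ?E *\<^sub>R \<xi> p + (a 4 * \<epsilon>) *\<^sub>R ?Q) = 0"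
    by simp
  moreover have "inverse (a 4 * \<epsilon>) * (a 4 * \<epsilon>) = 1" by (rule left_inverse[OF e(1)])
  moreover have "inverse (a 4 * \<epsilon>) * ?C = - ?c" "inverse (a 4 * \<epsilon>) * ?E = - ?d"
    using e a4 by (simp_all add: field_simps)
  ultimately have "(- ?c) *\<^sub>R X + (- ?d) *\<^sub>R \<xi> p + 1 *\<^sub>R ?Q = 0"
    by (simp only: scaleR_add_right scaleR_scaleR)
  then have "1 *\<^sub>R ?Q = - ((- ?c) *\<^sub>R X + (- ?d) *\<^sub>R \<xi> p)" by (rule iffD1[OF add_eq_0_iff])
  then show ?thesis
    by (simp only: scaleR_minus_left scaleR_one minus_add_distrib minus_minus)
qed

text \<open>If \<open>a 4\<close> vanishes, then the trace of the equation and its value at \<open>\<xi>\<close> are two linear equations for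
  its two coefficients, independent when the dimension is not one.\<close>

lemma xi_T_flat_coefficients_zero:
  assumes flat: "xi_T_flat M A g a \<xi>" and p: "p \<in> topspace M"
    and a4: "a 4 = 0" and n: "CARD('n) \<ge> 2"
  defines "n \<equiv> real CARD('n)" and "r \<equiv> scalar_curvature A g p"
  shows "k * a 0 + k * (n - 1) * a 1 + a 7 * r = 0"
    and "(n - 1) * k * (a 2 + a 3 + a 5 + a 6) - k * a 0 - a 7 * r = 0"
proof -
  define C where "C = k * a 0 + k * (n - 1) * a 1 + a 7 * r"
  define E where "E = (n - 1) * k * (a 2 + a 3 + a 5 + a 6) - k * a 0 - a 7 * r"
  note xi = xi_tangent[OF p]
  have eq: "0 = (\<epsilon> * C) *\<^sub>R X + (g p X (\<xi> p) * E) *\<^sub>R \<xi> p" if "X \<in> tangent_space A p" for X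
    using xi_T_flat_equation[OF flat p that] a4 by (simp add: C_def E_def n_def r_def)
  have e: "\<epsilon> \<noteq> 0" using epsilon by auto
  have "g p (0 *\<^sub>R \<xi> p) (\<xi> p) = 0" using metric_scaleR[OF p xi xi, of 0] by simp
  then have "\<xi> p \<noteq> 0" using xi_unit[OF p] e by auto
  moreover have "(\<epsilon> * C + \<epsilon> * E) *\<^sub>R \<xi> p = 0"
    using eq[OF xi] xi_unit[OF p] by (simp add: scaleR_add_left)
  ultimately have "\<epsilon> * C + \<epsilon> * E = 0" by simp
  then have "\<epsilon> * (C + E) = 0" by (simp add: distrib_left)
  then have CE: "C + E = 0" using e by simp
  have "tangent_trace A p (\<lambda>X. 0) = n * (\<epsilon> * C) + g p (\<xi> p) (\<xi> p) * E"
    unfolding n_def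
    by (rule tangent_trace_scalar_plus_rank_one[OF p xi eq])
      (simp_all add: metric_add metric_scaleR p xi algebra_simps)
  moreover have "tangent_trace A p (\<lambda>X. 0) = 0"
    by (simp add: tangent_trace_def Let_def trace_matrix)
  ultimately have "\<epsilon> * (n * C + E) = 0"
    using xi_unit[OF p] by (simp add: algebra_simps)
  then have "n * C + E = 0" using e by simp
  moreover have "(n - 1) * C = (n * C + E) - (C + E)" by (simp add: algebra_simps)
  ultimately have "(n - 1) * C = 0" using CE by simp
  then have "C = 0" using n unfolding n_def by simp
  then show "k * a 0 + k * (n - 1) * a 1 + a 7 * r = 0"
    and "(n - 1) * k * (a 2 + a 3 + a 5 + a 6) - k * a 0 - a 7 * r = 0"
    using CE unfolding C_def E_def by simp_all
qed

end

theorem theorem4p2: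
  fixes M :: "'m topology" and A :: "('m, 'n::finite) chart set" and g :: "('m, 'n) metric_field"
    and k \<epsilon> :: real and \<xi> :: "'m \<Rightarrow> ('m, 'n) tangent_vector"
    and a :: "nat \<Rightarrow> real" and n :: nat and r D2 D3 :: "'m \<Rightarrow> real"
  assumes N_xi: "N_xi_manifold M A g k \<xi> \<epsilon>"
    and dimension: "n = CARD('n)"
    and flat: "xi_T_flat M A g a \<xi>"
    and r: "r = scalar_curvature A g"
    and D2: "D2 = (\<lambda>p. - (k * a 0 + k * (real n - 1) * a 1 + a 7 * r p) / a 4)"
    and D3: "D3 = (\<lambda>p. (k * a 0 - (real n - 1) * k * (a 2 + a 3 + a 5 + a 6) + a 7 * r p)
                        / (\<epsilon> * a 4))"
  shows
    "(a 4 \<noteq> 0 \<and> a 4 + (real n - 1) * a 7 \<noteq> 0 \<longrightarrow>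
        (\<forall>p\<in>topspace M. \<forall>X\<in>tangent_space A p. \<forall>Y\<in>tangent_space A p.
           ricci A g p X Y = D2 p * g p X Y + D3 p * (eta g \<xi> \<epsilon> p X * eta g \<xi> \<epsilon> p Y)) \<and>
        eta_Einstein M A g \<xi> \<epsilon> \<and>
        (\<forall>p\<in>topspace M. r p = - (k * (real n - 1) * (a 0 + real n * a 1 + a 2 + a 3 + a 5 + a 6))
                              / (a 4 + (real n - 1) * a 7)) \<and>
        ((\<forall>p\<in>topspace M. k * a 0 - (real n - 1) * k * (a 2 + a 3 + a 5 + a 6) + a 7 * r p = 0) \<longrightarrow>
           Einstein M A g)) \<and>
     (n \<ge> 2 \<and> a 4 = 0 \<and> a 7 \<noteq> 0 \<longrightarrow>
        (\<forall>p\<in>topspace M. r p = - (k * (a 0 + real n * a 1 + a 2 + a 3 + a 5 + a 6)) / a 7)) \<and>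
     (n \<ge> 2 \<and> a 4 = 0 \<and> a 7 = 0 \<longrightarrow>
        k = 0 \<or> a 0 + real n * a 1 + a 2 + a 3 + a 5 + a 6 = 0)"
proof -
  interpret N_xi_manifold M A g k \<xi> \<epsilon> by (rule N_xi)
  let ?\<Sigma> = "a 0 + real n * a 1 + a 2 + a 3 + a 5 + a 6"
  let ?r0 = "- (k * (real n - 1) * ?\<Sigma>) / (a 4 + (real n - 1) * a 7)"
  have e: "\<epsilon> * \<epsilon> = 1" "\<epsilon> \<noteq> 0" using epsilon by auto
  have ricci_eq: "ricci A g p X Y = D2 p * g p X Y + D3 p * (eta g \<xi> \<epsilon> p X * eta g \<xi> \<epsilon> p Y)"
    and r_eq: "r p = real n * D2 p + D3 p * \<epsilon>"
    if a4: "a 4 \<noteq> 0" and p: "p \<in> topspace M" and X: "X \<in> tangent_space A p" and Y: "Y \<in> tangent_space A p"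
    for p X Y
  proof -
    note xi = xi_tangent[OF p]
    have Q: "ricci_operator A g p X = D2 p *\<^sub>R X + (D3 p * g p X (\<xi> p)) *\<^sub>R \<xi> p"
      if "X \<in> tangent_space A p" for X
      using xi_T_flat_ricci_operator[OF flat p that a4] by (simp add: D2 D3 dimension r)
    have "ricci A g p X Y = g p (D2 p *\<^sub>R X + (D3 p * g p X (\<xi> p)) *\<^sub>R \<xi> p) Y"
      using metric_ricci_operator[OF p Y, of X] Q[OF X] by simp
    also have "\<dots> = D2 p * g p X Y + D3 p * (g p X (\<xi> p) * g p Y (\<xi> p))"
      using X Y xi subspace_tangent_space[OF p] metric_sym[OF p Y xi]
      by (simp add: metric_add metric_scaleR p subspace_scale)
    also have "g p X (\<xi> p) * g p Y (\<xi> p) = eta g \<xi> \<epsilon> p X * eta g \<xi> \<epsilon> p Y"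
      using e(1) by (simp add: eta_def)
    finally show "ricci A g p X Y = D2 p * g p X Y + D3 p * (eta g \<xi> \<epsilon> p X * eta g \<xi> \<epsilon> p Y)" .
    have "tangent_trace A p (ricci_operator A g p) = real CARD('n) * D2 p + D3 p * g p (\<xi> p) (\<xi> p)"
      by (rule tangent_trace_scalar_plus_rank_one[OF p xi Q])
        (simp_all add: metric_add metric_scaleR p xi algebra_simps)
    then show "r p = real n * D2 p + D3 p * \<epsilon>"
      using xi_unit[OF p] by (simp add: r scalar_curvature_def dimension)
  qed
  have 1: "(\<forall>p\<in>topspace M. \<forall>X\<in>tangent_space A p. \<forall>Y\<in>tangent_space A p.
           ricci A g p X Y = D2 p * g p X Y + D3 p * (eta g \<xi> \<epsilon> p X * eta g \<xi> \<epsilon> p Y)) \<and>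
        eta_Einstein M A g \<xi> \<epsilon> \<and> (\<forall>p\<in>topspace M. r p = ?r0) \<and>
        ((\<forall>p\<in>topspace M. k * a 0 - (real n - 1) * k * (a 2 + a 3 + a 5 + a 6) + a 7 * r p = 0) \<longrightarrow>
           Einstein M A g)"
    if a4: "a 4 \<noteq> 0" and den: "a 4 + (real n - 1) * a 7 \<noteq> 0"
  proof -
    have r0: "r p = ?r0" if p: "p \<in> topspace M" for p
    proof -
      have "r p * a 4 = real n * (D2 p * a 4) + \<epsilon> * a 4 * D3 p"
        using r_eq[OF a4 p xi_tangent[OF p] xi_tangent[OF p]] by (simp add: algebra_simps)
      moreover have "D2 p * a 4 = - (k * a 0 + k * (real n - 1) * a 1 + a 7 * r p)"
        "\<epsilon> * a 4 * D3 p = k * a 0 - (real n - 1) * k * (a 2 + a 3 + a 5 + a 6) + a 7 * r p"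
        using a4 e(2) by (simp_all add: D2 D3)
      ultimately have "r p * (a 4 + (real n - 1) * a 7) = - (k * (real n - 1) * ?\<Sigma>)"
        by (simp add: algebra_simps)
      then show ?thesis by (rule iffD2[OF nonzero_eq_divide_eq[OF den]])
    qed
    \<comment> \<open>The scalar curvature is constant, so both coefficients are constant on \<open>M\<close>.\<close>
    define d2 where "d2 = - (k * a 0 + k * (real n - 1) * a 1 + a 7 * ?r0) / a 4"
    define d3 where "d3 = (k * a 0 - (real n - 1) * k * (a 2 + a 3 + a 5 + a 6) + a 7 * ?r0) / (\<epsilon> * a 4)"
    have const: "D2 p = d2" "D3 p = d3" if "p \<in> topspace M" for p
      by (simp_all only: D2 D3 d2_def d3_def r0[OF that])
    have "smooth_function A (\<lambda>_. t)" for t :: real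
      by (simp add: smooth_function_def smooth_on_def o_def Ck_on_const)
    then have "eta_Einstein M A g \<xi> \<epsilon>"
      unfolding eta_Einstein_def
      using ricci_eq[OF a4] const by (intro exI[of _ "\<lambda>_. d2"] exI[of _ "\<lambda>_. d3"]) simp
    moreover have "Einstein M A g"
      if 0: "\<forall>p\<in>topspace M. k * a 0 - (real n - 1) * k * (a 2 + a 3 + a 5 + a 6) + a 7 * r p = 0"
    proof -
      have "D3 p = 0" if "p \<in> topspace M" for p using 0 that by (simp add: D3)
      then show ?thesis
        unfolding Einstein_def using ricci_eq[OF a4] const by (intro exI[of _ d2]) simp
    qed
    ultimately show ?thesis using ricci_eq[OF a4] r0 by blast
  qed
  have zero: "a 7 * r p = - (k * ?\<Sigma>)" if "n \<ge> 2" "a 4 = 0" "p \<in> topspace M" for p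
  proof -
    have 1: "k * a 0 + k * (real n - 1) * a 1 + a 7 * r p = 0"
      and 2: "(real n - 1) * k * (a 2 + a 3 + a 5 + a 6) - k * a 0 - a 7 * r p = 0"
      using xi_T_flat_coefficients_zero[OF flat that(3,2)] that(1) by (simp_all add: dimension r)
    have "(real n - 1) * (k * (a 1 + a 2 + a 3 + a 5 + a 6)) = 0"
      using 1 2 by (simp add: algebra_simps)
    then have "k * (a 1 + a 2 + a 3 + a 5 + a 6) = 0" using that(1) by simp
    then show ?thesis using 1 by (simp add: algebra_simps)
  qed
  have 2: "r p = - (k * ?\<Sigma>) / a 7" if "n \<ge> 2" "a 4 = 0" "a 7 \<noteq> 0" "p \<in> topspace M" for p
    using zero[OF that(1,2,4)]
    by (intro iffD2[OF nonzero_eq_divide_eq[OF that(3)]]) (simp only: mult.commute[of "r p"])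
  have 3: "k = 0 \<or> ?\<Sigma> = 0" if "n \<ge> 2" "a 4 = 0" "a 7 = 0"
  proof -
    obtain p where "p \<in> topspace M" using nonempty by blast
    from zero[OF that(1,2) this] that(3) show ?thesis by simp
  qed
  show ?thesis using 1 2 3 by blast
qed

end
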